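(* Let $\mathfrak H$ be a Hilbert space, $t\in[0,\pi]$, and $0\le p\le q\le\frac{\pi}{\sin t}$ (no upper bound on $q$ if $\sin t=0$). Let $\phi$ be a $\mathcal B(\mathfrak H)$-valued ordered measure with $\int\|\phi\|_2\le q-p$, and let $B=\exp_{\mathrm L}(\phi)$. Then for every $A\in\mathcal B(\mathfrak H)$, $$\mathcal E_{p,t}(A)\ \Longrightarrow\ \mathcal E_{q,t}(BA).$$
   Context: For $A\in\mathcal B(\mathfrak H)$, $p\ge0$ and $t\in(0,\pi)$, $\mathcal E_{p,t}(A)$ denotes the operator inequality $$-\frac{\mathrm e^{-p\cos t}\sin(t+p\sin t)}{\sin t}\,A^*A+(A^*+A)-\frac{\mathrm e^{p\cos t}\sin(t-p\sin t)}{\sin t}\,\mathrm{Id}\ \ge\ 0 .$$ For $t=0$ it is $-(1+p)\mathrm e^{-p}A^*A+(A+A^* )-(1-p)\mathrm e^{p}\,\mathrm{Id}\ge0$, and for $t=\pi$ it is $-(1-p)\mathrm e^{p}A^*A+(A+A^* )-(1+p)\mathrm e^{-p}\,\mathrm{Id}\ge0$. $\mathfrak H$ is real or complex, $\|\cdot\|_2$ is the operator norm. A $\mathcal B(\mathfrak H)$-valued ordered measure $\phi$ is a nonatomic countably additive $\mathcal B(\mathfrak H)$-valued Borel measure on an interval $I\subset\mathbb R$ with finite total variation $\int\|\phi\|_2$. Its left time-ordered exponential is $\exp_{\mathrm L}(\phi)=\mathrm{Id}+\sum_{k\ge1}\int_{t_1\le\dots\le t_k\in I}\phi(t_k)\cdots\phi(t_1)$,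 equivalently the limit, along refining partitions of $I$ into consecutive intervals $I_1<\dots<I_n$, of $\exp(\phi(I_n))\cdots\exp(\phi(I_1))$. *)

theory Defs
  imports "HOL-Analysis.Analysis"
begin

text \<open>
  A real Hilbert space is a type of sort real_inner, complete_space.  A complex Hilbert
  space is presented together with its underlying real Hilbert space, whose inner product is the
  real part of the complex one.  In particular the norm is the one of the complex
  inner product, because conjugate symmetry makes cinner x x real.  The form is linear in the first
  argument.
\<close>

class complex_hilbert_space = real_inner + complete_space +
  fixes scaleC :: "complex \<Rightarrow> 'a \<Rightarrow> 'a"
    and cinner :: "'a \<Rightarrow> 'a \<Rightarrow> complex"
  assumes scaleC_add_right: "scaleC c (x + y) = scaleC c x + scaleC c y"
    and scaleC_add_left: "scaleC (c + d) x = scaleC c x + scaleC d x"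
    and scaleC_scaleC: "scaleC c (scaleC d x) = scaleC (c * d) x"
    and scaleR_scaleC: "scaleR r x = scaleC (complex_of_real r) x"
    and cinner_commute: "cinner x y = cnj (cinner y x)"
    and cinner_add_left: "cinner (x + y) z = cinner x z + cinner y z"
    and cinner_scaleC_left: "cinner (scaleC c x) y = c * cinner x y"
    and inner_Re_cinner: "inner x y = Re (cinner x y)"

text \<open>
  For a complex Hilbert space the bounded operators are the complex-linear members of the
  type of real bounded operators; the operator norm is the same for both scalar fields.
\<close>

definition complex_linear :: "('h::complex_hilbert_space \<Rightarrow>\<^sub>L 'h) \<Rightarrow> bool" where
  "complex_linear A \<longleftrightarrow> (\<forall>c x. blinfun_apply A (scaleC c x) = scaleC c (blinfun_apply A x))"

text \<open>
  Adjoint and positivity are taken with respect to a form ip, which is inner in the real case and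
  cinner in the complex case.  Self-adjointness is part of positivity, as it has to be over the
  reals.
\<close>

definition op_adjoint ::
    "('h \<Rightarrow> 'h \<Rightarrow> 'k::real_normed_field) \<Rightarrow> ('h::real_normed_vector \<Rightarrow>\<^sub>L 'h) \<Rightarrow> ('h \<Rightarrow>\<^sub>L 'h)" where
  "op_adjoint ip A = (THE B. \<forall>x y. ip (blinfun_apply A x) y = ip x (blinfun_apply B y))"

definition op_nonneg ::
    "('h \<Rightarrow> 'h \<Rightarrow> 'k::real_normed_field) \<Rightarrow> ('h::real_normed_vector \<Rightarrow>\<^sub>L 'h) \<Rightarrow> bool" where
  "op_nonneg ip T \<longleftrightarrow>
     (\<forall>x y. ip (blinfun_apply T x) y = ip x (blinfun_apply T y)) \<and>
     (\<forall>x. ip (blinfun_apply T x) x \<in> \<real>\<^sub>\<ge>\<^sub>0)"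

definition calE_quad_coeff :: "real \<Rightarrow> real \<Rightarrow> real" where
  "calE_quad_coeff p t =
     (if t = 0 then (1 + p) * exp (- p)
      else if t = pi then (1 - p) * exp p
      else exp (- p * cos t) * sin (t + p * sin t) / sin t)"

definition calE_const_coeff :: "real \<Rightarrow> real \<Rightarrow> real" where
  "calE_const_coeff p t =
     (if t = 0 then (1 - p) * exp p
      else if t = pi then (1 + p) * exp (- p)
      else exp (p * cos t) * sin (t - p * sin t) / sin t)"

definition calE ::
    "('h \<Rightarrow> 'h \<Rightarrow> 'k::real_normed_field) \<Rightarrow> real \<Rightarrow> real \<Rightarrow> ('h::real_normed_vector \<Rightarrow>\<^sub>L 'h) \<Rightarrow> bool"
  where
  "calE ip p t A \<longleftrightarrow>
     op_nonneg ip
       (- calE_quad_coeff p t *\<^sub>R (op_adjoint ip A o\<^sub>L A) + (op_adjoint ip A + A)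
        - calE_const_coeff p t *\<^sub>R id_blinfun)"

definition variation :: "(real set \<Rightarrow> 'b::real_normed_vector) \<Rightarrow> real set \<Rightarrow> ennreal" where
  "variation \<phi> E =
     (SUP P \<in> {P. finite P \<and> P \<subseteq> sets borel \<and> disjoint P \<and> \<Union>P = E}.
        \<Sum>A\<in>P. ennreal (norm (\<phi> A)))"

text \<open>
  A measure on I is a function on all sets of reals of which only the values on Borel subsets of I
  matter.  Nonatomicity is the usual notion for the variation measure.
\<close>

definition ordered_measure :: "real set \<Rightarrow> (real set \<Rightarrow> 'b::real_normed_vector) \<Rightarrow> bool" where
  "ordered_measure I \<phi> \<longleftrightarrow>
     is_interval I \<and>
     (\<forall>E::nat \<Rightarrow> real set. (\<forall>n. E n \<in> sets borel \<and> E n \<subseteq> I) \<longrightarrow> disjoint_family E \<longrightarrow>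
        (\<lambda>n. \<phi> (E n)) sums \<phi> (\<Union>n. E n)) \<and>
     (\<forall>E. E \<in> sets borel \<longrightarrow> E \<subseteq> I \<longrightarrow> 0 < variation \<phi> E \<longrightarrow>
        (\<exists>F. F \<in> sets borel \<and> F \<subseteq> E \<and> 0 < variation \<phi> F \<and> variation \<phi> F < variation \<phi> E)) \<and>
     variation \<phi> I < \<infinity>"

text \<open>
  The integral over E of phi(ds) f(s) for an operator-valued f that is a uniform limit of simple
  functions.  The value phi(ds) multiplies from the left.  When phi has finite variation, the limit
  does not depend on the approximating sequence.
\<close>

definition simple_op_integral ::
    "(real set \<Rightarrow> ('h::real_normed_vector \<Rightarrow>\<^sub>L 'h)) \<Rightarrow> real set \<Rightarrow> (real \<Rightarrow> ('h \<Rightarrow>\<^sub>L 'h)) \<Rightarrow> ('h \<Rightarrow>\<^sub>L 'h)"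
  where
  "simple_op_integral \<phi> E s = (\<Sum>y\<in>s ` E. \<phi> (s -` {y} \<inter> E) o\<^sub>L y)"

definition has_op_integral ::
    "(real set \<Rightarrow> ('h::real_normed_vector \<Rightarrow>\<^sub>L 'h)) \<Rightarrow> real set \<Rightarrow> (real \<Rightarrow> ('h \<Rightarrow>\<^sub>L 'h)) \<Rightarrow> ('h \<Rightarrow>\<^sub>L 'h) \<Rightarrow> bool"
  where
  "has_op_integral \<phi> E f v \<longleftrightarrow>
     (\<exists>s::nat \<Rightarrow> real \<Rightarrow> ('h \<Rightarrow>\<^sub>L 'h).
        (\<forall>n. simple_function (restrict_space borel E) (s n)) \<and>
        uniform_limit E s f sequentially \<and>
        (\<lambda>n. simple_op_integral \<phi> E (s n)) \<longlonglongrightarrow> v)"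

definition op_integral ::
    "(real set \<Rightarrow> ('h::real_normed_vector \<Rightarrow>\<^sub>L 'h)) \<Rightarrow> real set \<Rightarrow> (real \<Rightarrow> ('h \<Rightarrow>\<^sub>L 'h)) \<Rightarrow> ('h \<Rightarrow>\<^sub>L 'h)"
  where
  "op_integral \<phi> E f = (THE v. has_op_integral \<phi> E f v)"

text \<open>
  The integral of phi(t_k) ... phi(t_1) over t_1 \<le> ... \<le> t_k in J, iterated with the latest
  variable t_k outermost: the remaining variables then range over J \<inter> {..t_k}.
\<close>

primrec time_ordered_integral ::
    "(real set \<Rightarrow> ('h::real_normed_vector \<Rightarrow>\<^sub>L 'h)) \<Rightarrow> nat \<Rightarrow> real set \<Rightarrow> ('h \<Rightarrow>\<^sub>L 'h)" where
  "time_ordered_integral \<phi> 0 J = id_blinfun"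
| "time_ordered_integral \<phi> (Suc k) J =
     op_integral \<phi> J (\<lambda>t. time_ordered_integral \<phi> k (J \<inter> {..t}))"

definition exp_L ::
    "real set \<Rightarrow> (real set \<Rightarrow> ('h::real_normed_vector \<Rightarrow>\<^sub>L 'h)) \<Rightarrow> ('h \<Rightarrow>\<^sub>L 'h)" where
  "exp_L I \<phi> = id_blinfun + (\<Sum>k. time_ordered_integral \<phi> (Suc k) I)"

end

theory Submission
  imports Defs "HOL-Real_Asymp.Real_Asymp"
begin

text \<open>
  For a fixed vector x the inequality depends on A only through y = A x, so it suffices to follow the
  path s \<mapsto> U s y, where U s is the time-ordered exponential of the part of the measure before s.
  Parametrized by variation, its speed is at most its norm. Let Q p x y be the quadratic form of the
  inequality with parameter p, with coefficients a p and c p. They satisfy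
  a' = - exp (- p cos t) r, c' = - exp (p cos t) r and 1 - a c = r ^ 2 for r = sin (p sin t) / sin t
  (r = p if sin t = 0).
  Hence on the boundary Q = 0 the gradient x - a y has norm r times that of x, and the derivative of Q
  along the path is at least r (exp (- p cos t / 2) |y| - exp (p cos t / 2) |x|) ^ 2, which is
  nonnegative. The path is only Lipschitz, so it is replaced by polygons, whose lengths tend to the
  variation. The argument needs r > 0. If p = 0 then y = x, and Q p x x is nonnegative for small p
  because a and c decrease from 1; if q sin t = pi then Q q is nonnegative everywhere.
\<close>

section \<open>Operators on real and complex Hilbert spaces\<close>

text \<open>The path is sampled at finitely many times. If the variation between two of them is h,
  the integral equation of the exponential bounds the chord by h / (1 - h) times the norm of its
  starting point, whatever the path does in between. A straight segment with this bound can be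
  travelled within the speed limit in time ln ((1 - h) / (1 - 2 * h)), slightly more than h, so the
  parameter overshoots q. This is harmless: with h = (q - p) / n the overshoot tends to 0, the
  strict inequality q sin t < pi leaves room for it, and the form is continuous in the parameter.
  The starting parameter is moved to p + 1 / n at the same time, which brings p = 0 into the range r
  > 0. In this way neither derivatives of the exponential nor its multiplicativity are used. Over
  the complex numbers the inequality is tested on real parts of the same inner products, so that
  case follows from the real one once the exponential is known to be complex linear.\<close>

lemma Cauchy_blinfun_convergent:
  fixes X :: "nat \<Rightarrow> ('a::real_normed_vector \<Rightarrow>\<^sub>L 'b::{real_normed_vector,complete_space})"
  assumes X: "Cauchy X"
  shows "convergent X"
proof -
  have pt: "Cauchy (\<lambda>n. X n x)" for x
    using bounded_linear.Cauchy[OF blinfun.bounded_linear_left X] .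
  define L where "L x = lim (\<lambda>n. X n x)" for x
  have L: "(\<lambda>n. X n x) \<longlonglongrightarrow> L x" for x
    unfolding L_def using Cauchy_convergent[OF pt] by (simp add: convergent_LIMSEQ_iff)
  obtain K where K: "\<And>n. norm (X n) \<le> K"
    using Cauchy_Bseq[OF X] by (auto simp: Bseq_def)
  have bl: "bounded_linear L"
  proof (rule bounded_linear_intro[of _ K])
    show "L (x + y) = L x + L y" for x y
      by (rule LIMSEQ_unique[OF L]) (auto simp: blinfun.add_right intro!: tendsto_add L)
    show "L (r *\<^sub>R x) = r *\<^sub>R L x" for r x
      by (rule LIMSEQ_unique[OF L]) (auto simp: blinfun.scaleR_right intro!: tendsto_scaleR L)
    show "norm (L x) \<le> norm x * K" for x
    proof (rule LIMSEQ_le_const2[OF tendsto_norm[OF L]], intro exI allI impI)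
      show "norm (X n x) \<le> norm x * K" for n
        using norm_blinfun[of "X n" x] mult_right_mono[OF K, of "norm x" n]
        by (simp add: mult.commute)
    qed
  qed
  have "X \<longlonglongrightarrow> Blinfun L"
  proof (rule LIMSEQ_I)
    fix r :: real assume "0 < r"
    then obtain M where M: "\<And>m n. m \<ge> M \<Longrightarrow> n \<ge> M \<Longrightarrow> norm (X m - X n) < r/2"
      using X unfolding Cauchy_iff by (meson half_gt_zero)
    \<comment> \<open>The Cauchy estimate holds for every index m beyond M, so it survives the
      pointwise limit in m with a constant independent of x.\<close>
    have "norm (X n - Blinfun L) \<le> r/2" if n: "n \<ge> M" for n
    proof (rule norm_blinfun_bound)
      fix x
      have "(\<lambda>m. norm (X n x - X m x)) \<longlonglongrightarrow> norm (X n x - L x)"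
        by (intro tendsto_intros L)
      moreover have "norm (X n x - X m x) \<le> r/2 * norm x" if "m \<ge> M" for m
      proof -
        have "norm ((X n - X m) x) \<le> norm (X n - X m) * norm x" by (rule norm_blinfun)
        also have "\<dots> \<le> r/2 * norm x" using M[OF n that] by (intro mult_right_mono) auto
        finally show ?thesis by (simp add: blinfun.diff_left)
      qed
      ultimately have "norm (X n x - L x) \<le> r/2 * norm x"
        by (intro LIMSEQ_le_const2) auto
      then show "norm ((X n - Blinfun L) x) \<le> r/2 * norm x"
        by (simp add: blinfun.diff_left bounded_linear_Blinfun_apply[OF bl])
    qed (use \<open>0 < r\<close> in simp)
    moreover have "r/2 < r" using \<open>0 < r\<close> by simp
    ultimately show "\<exists>N. \<forall>n\<ge>N. norm (X n - Blinfun L) < r"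
      using le_less_trans by blast
  qed
  then show ?thesis by (rule convergentI)
qed

text \<open>
  The type class banach is not implied by the sort of real_normed_vector and complete_space, so
  the library instance of completeness for bounded operators does not apply to real Hilbert spaces.
\<close>

instance blinfun :: (real_normed_vector, "{real_normed_vector,complete_space}") complete_space
  by standard (rule Cauchy_blinfun_convergent)

instance blinfun :: (real_normed_vector, "{real_normed_vector,complete_space}") banach ..

text \<open>
  The representing vector is the minimizer of the functional norm x ^ 2 / 2 - f x: minimizing
  sequences are Cauchy by the parallelogram law.
\<close>

lemma riesz_representation:
  fixes f :: "'a::{real_inner,complete_space} \<Rightarrow> real"
  assumes f: "bounded_linear f"
  shows "\<exists>z. \<forall>x. f x = inner x z"
proof -
  interpret f: bounded_linear f by (rule f)
  define J where "J x = (norm x)\<^sup>2 / 2 - f x" for x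
  obtain K where K: "\<And>x. norm (f x) \<le> norm x * K" using f.bounded by blast
  have lower: "J x \<ge> - (K\<^sup>2 / 2)" for x
  proof -
    have "f x \<le> norm x * K" using K[of x] by simp
    moreover have "0 \<le> (norm x - K)\<^sup>2" by simp
    ultimately show ?thesis unfolding J_def by (simp add: power2_diff)
  qed
  define m where "m = Inf (range J)"
  have bdd: "bdd_below (range J)" using lower by (meson bdd_belowI2)
  have m_le: "m \<le> J x" for x unfolding m_def by (rule cInf_lower[OF _ bdd]) simp
  have "\<exists>x. J x < m + 1 / real (Suc n)" for n
  proof -
    have "Inf (range J) < m + 1 / real (Suc n)" by (simp add: m_def)
    then show ?thesis using cInf_less_iff[of "range J"] bdd by auto
  qed
  then obtain X where X: "\<And>n. J (X n) < m + 1 / real (Suc n)" by metis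
  have par: "(norm (x - y))\<^sup>2 \<le> 4 * (J x + J y - 2 * m)" for x y
  proof -
    have "J x + J y - 2 * J ((1/2) *\<^sub>R (x + y)) = (norm (x - y))\<^sup>2 / 4"
      unfolding J_def
      by (simp add: f.scaleR f.add power2_norm_eq_inner inner_add_left inner_add_right
          inner_diff_left inner_diff_right inner_commute field_simps)
    then show ?thesis using m_le[of "(1/2) *\<^sub>R (x + y)"] by simp
  qed
  have "Cauchy X"
  proof (rule metric_CauchyI)
    fix e :: real assume "0 < e"
    then obtain N where N: "1 / real (Suc N) < e\<^sup>2 / 8"
      using nat_approx_posE[of "e\<^sup>2 / 8"] by (auto simp del: of_nat_Suc)
    show "\<exists>M. \<forall>i\<ge>M. \<forall>j\<ge>M. dist (X i) (X j) < e"
    proof (intro exI allI impI)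
      fix i j assume "N \<le> i" "N \<le> j"
      then have "1 / real (Suc i) \<le> 1 / real (Suc N)" "1 / real (Suc j) \<le> 1 / real (Suc N)"
        by (simp_all add: divide_simps)
      then have "J (X i) < m + e\<^sup>2 / 8" "J (X j) < m + e\<^sup>2 / 8"
        using X[of i] X[of j] N by linarith+
      then have "(norm (X i - X j))\<^sup>2 < e\<^sup>2"
        using par[of "X i" "X j"] by argo
      then show "dist (X i) (X j) < e"
        using \<open>0 < e\<close> by (simp add: dist_norm power_less_imp_less_base)
    qed
  qed
  then obtain z where z: "X \<longlonglongrightarrow> z" using Cauchy_convergent convergentD by blast
  have "(\<lambda>n. J (X n)) \<longlonglongrightarrow> J z"
    unfolding J_def by (intro tendsto_intros f.tendsto z) simp
  moreover have "(\<lambda>n. m + 1 / real (Suc n)) \<longlonglongrightarrow> m + 0"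
    by (intro tendsto_add tendsto_const lim_1_over_n[THEN LIMSEQ_Suc])
  ultimately have "J z \<le> m + 0"
    by (rule LIMSEQ_le) (intro exI allI impI less_imp_le X)
  then have min: "J z \<le> J y" for y using m_le[of y] by simp
  have "f x = inner x z" for x
  proof (cases "x = 0")
    case False
    define c where "c = inner x z - f x"
    \<comment> \<open>This quadratic in s is smallest at s = - c / norm x ^ 2, where it lies c ^ 2 /
      (2 norm x ^ 2) below J z; minimality of z then forces c = 0.\<close>
    have "J (z + s *\<^sub>R x) = J z + s * c + s\<^sup>2 * (norm x)\<^sup>2 / 2" for s
      unfolding J_def c_def power2_norm_eq_inner
      by (simp add: f.scaleR f.add inner_add_left inner_add_right
          inner_commute field_simps power2_eq_square)
    moreover have "- c / n * c + (- c / n)\<^sup>2 * n / 2 = - (c\<^sup>2 / (2 * n))" if "n \<noteq> 0" for n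
      using that by (simp add: field_simps power2_eq_square)
    from this[of "(norm x)\<^sup>2"] False
    have "- c / (norm x)\<^sup>2 * c + (- c / (norm x)\<^sup>2)\<^sup>2 * (norm x)\<^sup>2 / 2 = - (c\<^sup>2 / (2 * (norm x)\<^sup>2))"
      by simp
    ultimately have "J (z + (- c / (norm x)\<^sup>2) *\<^sub>R x) = J z + - (c\<^sup>2 / (2 * (norm x)\<^sup>2))"
      by (metis add.assoc)
    then have "0 \<le> - (c\<^sup>2 / (2 * (norm x)\<^sup>2))"
      using min[of "z + (- c / (norm x)\<^sup>2) *\<^sub>R x"] by linarith
    then have "c\<^sup>2 \<le> 0" using False by (simp add: divide_le_0_iff)
    then have "c = 0" by simp
    then show ?thesis by (simp add: c_def)
  qed (simp add: f.zero)
  then show ?thesis by blast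
qed

text \<open>The Riesz vector of the functional x \<mapsto> \<open>inner (A x) y\<close> depends
  linearly on y because inner products separate vectors; testing with x = \<open>b y\<close> bounds
  it by \<open>norm A\<close>.\<close>

lemma adjoint_exists:
  fixes A :: "'a::{real_inner,complete_space} \<Rightarrow>\<^sub>L 'a"
  shows "\<exists>B :: 'a \<Rightarrow>\<^sub>L 'a. \<forall>x y. inner (A x) y = inner x (B y)"
proof -
  have "\<exists>z. \<forall>x. inner (A x) y = inner x z" for y
    by (rule riesz_representation)
      (rule bounded_linear_compose[OF bounded_linear_inner_left blinfun.bounded_linear_right])
  then obtain b where b: "\<And>x y. inner (A x) y = inner x (b y)" by metis
  have eqI: "u = v" if "\<And>x. inner x u = inner x v" for u v :: 'a
  proof -
    have "inner (u - v) (u - v) = 0" using that[of "u - v"] by (simp add: inner_diff_right)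
    then show ?thesis by simp
  qed
  have "bounded_linear b"
  proof (rule bounded_linear_intro[of _ "norm A"])
    show "b (x + y) = b x + b y" for x y
      by (rule eqI) (simp add: inner_add_right flip: b)
    show "b (r *\<^sub>R x) = r *\<^sub>R b x" for r x
      by (rule eqI) (simp flip: b)
    show "norm (b y) \<le> norm y * norm A" for y
    proof (cases "b y = 0")
      case False
      have "norm (b y) * norm (b y) = inner (A (b y)) y"
        by (simp add: b flip: power2_norm_eq_inner power2_eq_square)
      also have "\<dots> \<le> norm (A (b y)) * norm y" by (rule norm_cauchy_schwarz)
      also have "\<dots> \<le> norm A * norm (b y) * norm y" by (intro mult_right_mono norm_blinfun) simp
      finally have "norm (b y) * norm (b y) \<le> norm (b y) * (norm y * norm A)"
        by (simp add: mult_ac)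
      then show ?thesis using False by simp
    qed simp
  qed
  then show ?thesis using b bounded_linear_Blinfun_apply[of b] by metis
qed

lemma op_adjoint_inner:
  fixes A :: "'a::{real_inner,complete_space} \<Rightarrow>\<^sub>L 'a"
  shows "inner (A x) y = inner x (op_adjoint inner A y)"
proof -
  obtain B :: "'a \<Rightarrow>\<^sub>L 'a" where B: "\<forall>x y. inner (A x) y = inner x (B y)"
    using adjoint_exists by blast
  have "C = B" if "\<forall>x y. inner (A x) y = inner x (C y)" for C :: "'a \<Rightarrow>\<^sub>L 'a"
  proof (rule blinfun_eqI)
    fix y
    have "inner (C y - B y) (C y - B y) = 0"
      using that B by (simp add: inner_diff_right)
    then show "C y = B y" by simp
  qed
  with B have "op_adjoint inner A = B" unfolding op_adjoint_def by (intro the_equality) auto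
  with B show ?thesis by simp
qed

section \<open>The quadratic form behind the operator inequality\<close>

definition qform :: "real \<Rightarrow> real \<Rightarrow> 'a::real_inner \<Rightarrow> 'a \<Rightarrow> real" where
  "qform p t x y =
     - calE_quad_coeff p t * (norm y)\<^sup>2 + 2 * inner x y - calE_const_coeff p t * (norm x)\<^sup>2"

text \<open>The symmetry that \<open>op_nonneg\<close> demands is automatic, since the operator is a
  real combination of the adjoint times A, of A plus its adjoint, and of the identity. Only the
  diagonal values carry information.\<close>

lemma calE_inner_iff:
  fixes A :: "'a::{real_inner,complete_space} \<Rightarrow>\<^sub>L 'a"
  shows "calE inner p t A \<longleftrightarrow> (\<forall>x. 0 \<le> qform p t x (A x))"
proof -
  let ?B = "op_adjoint inner A"
  let ?T = "- calE_quad_coeff p t *\<^sub>R (?B o\<^sub>L A) + (?B + A) - calE_const_coeff p t *\<^sub>R id_blinfun"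
  note adj = op_adjoint_inner[of A, symmetric]
  have adj': "inner (?B y) x = inner y (A x)" for x y
    using adj[of x y] by (simp add: inner_commute)
  have "inner (?T x) y = inner x (?T y)" for x y
    by (simp add: blinfun.diff_left blinfun.add_left blinfun.scaleR_left blinfun.minus_left inner_diff_left
        inner_diff_right inner_add_left inner_add_right adj adj')
  moreover have "inner (?T x) x = qform p t x (A x)" for x
    by (simp add: qform_def blinfun.diff_left blinfun.add_left blinfun.scaleR_left blinfun.minus_left inner_diff_left inner_diff_right
        inner_add_left inner_add_right adj adj' power2_norm_eq_inner inner_commute)
  ultimately show ?thesis
    unfolding calE_def op_nonneg_def by (simp add: nonneg_Reals_of_real_iff[where 'a = real, simplified])
qed

text \<open>Multiplication by i recovers imaginary parts from the real inner product, so complex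
  identities reduce to two real ones.\<close>

lemma Im_cinner: "Im (cinner x y) = - inner (scaleC \<i> x) y"
  by (simp add: inner_Re_cinner cinner_scaleC_left)

text \<open>The real adjoint satisfies the complex adjoint identity: real parts agree by its
  definition, imaginary parts because A commutes with multiplication by i. Uniqueness already
  follows from the real parts.\<close>

lemma op_adjoint_cinner:
  fixes A :: "'c::complex_hilbert_space \<Rightarrow>\<^sub>L 'c"
  assumes "complex_linear A"
  shows "op_adjoint cinner A = op_adjoint inner A"
    and "cinner (A x) y = cinner x (op_adjoint inner A y)"
proof -
  have eq: "cinner (A x) y = cinner x (op_adjoint inner A y)" for x y
  proof (rule complex_eqI)
    show "Re (cinner (A x) y) = Re (cinner x (op_adjoint inner A y))"
      by (simp add: op_adjoint_inner flip: inner_Re_cinner)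
    have "inner (scaleC \<i> (A x)) y = inner (A (scaleC \<i> x)) y"
      using assms by (simp add: complex_linear_def)
    then show "Im (cinner (A x) y) = Im (cinner x (op_adjoint inner A y))"
      by (simp add: Im_cinner op_adjoint_inner)
  qed
  have "C = op_adjoint inner A" if "\<forall>x y. cinner (A x) y = cinner x (C y)" for C :: "'c \<Rightarrow>\<^sub>L 'c"
  proof (rule blinfun_eqI)
    fix y
    have "inner (C y - op_adjoint inner A y) (C y - op_adjoint inner A y) = 0"
      using that eq by (simp add: inner_diff_right) (simp add: inner_Re_cinner)
    then show "C y = op_adjoint inner A y" by simp
  qed
  with eq show "op_adjoint cinner A = op_adjoint inner A"
    unfolding op_adjoint_def[of cinner] by (intro the_equality) auto
  show "cinner (A x) y = cinner x (op_adjoint inner A y)" by (rule eq)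
qed


text \<open>The operator is symmetric for \<open>cinner\<close>, so its diagonal values are real and
  coincide with those of the real form. Symmetry for \<open>inner\<close> is the real part of the
  complex symmetry.\<close>

lemma calE_cinner_iff:
  fixes A :: "'c::complex_hilbert_space \<Rightarrow>\<^sub>L 'c"
  assumes A: "complex_linear A"
  shows "calE cinner p t A \<longleftrightarrow> calE inner p t A"
proof -
  let ?B = "op_adjoint inner A"
  let ?T = "- calE_quad_coeff p t *\<^sub>R (?B o\<^sub>L A) + (?B + A) - calE_const_coeff p t *\<^sub>R id_blinfun"
  note adj = op_adjoint_cinner(2)[OF A, symmetric]
  have add_right: "cinner x (y + z) = cinner x y + cinner x z" for x y z :: 'c
    unfolding cinner_commute[of x] by (simp add: cinner_add_left)
  have scaleC_right: "cinner x (scaleC c y) = cnj c * cinner x y" for c and x y :: 'c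
    unfolding cinner_commute[of x] by (simp add: cinner_scaleC_left)
  have adj': "cinner (?B y) x = cinner y (A x)" for x y
    unfolding cinner_commute[of "?B y"] cinner_commute[of y] by (simp add: adj)
  define T where "T = ?T"
  have expand: "T x = scaleC (of_real (- calE_quad_coeff p t)) (?B (A x)) + (?B x + A x)
      + scaleC (of_real (- calE_const_coeff p t)) x" for x
    unfolding T_def by (simp add: blinfun.diff_left blinfun.add_left blinfun.scaleR_left blinfun.minus_left flip: scaleR_scaleC del: of_real_minus)
  have sym: "cinner (T x) y = cinner x (T y)" for x y
    unfolding expand by (simp add: cinner_add_left cinner_scaleC_left add_right scaleC_right adj adj')
  have real: "Im w = 0" if "w = cnj w" for w
    using arg_cong[OF that, of Im] by simp
  have "Im (cinner (T x) x) = 0" for x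
    by (rule real, rule trans[OF sym cinner_commute])
  then have nn: "cinner (T x) x \<in> \<real>\<^sub>\<ge>\<^sub>0 \<longleftrightarrow> inner (T x) x \<in> \<real>\<^sub>\<ge>\<^sub>0" for x
    by (simp add: complex_nonneg_Reals_iff inner_Re_cinner nonneg_Reals_of_real_iff[where 'a = real, simplified])
  have "inner (T x) y = inner x (T y)" for x y
    by (simp only: inner_Re_cinner sym)
  with sym nn have "op_nonneg cinner T \<longleftrightarrow> op_nonneg inner T"
    unfolding op_nonneg_def by simp
  then show ?thesis
    unfolding calE_def op_adjoint_cinner(1)[OF A] T_def .
qed

section \<open>Invariance of the form along paths\<close>

text \<open>Let a be \<open>calE_quad_coeff p t\<close> and x nonzero. Completing the square, the
  region \<open>0 \<le> qform p t x y\<close> of vectors y is for a > 0 the ball with centre x / a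
  and radius \<bar>\<open>circ_rad p t\<close>\<bar> / a times \<open>norm x\<close>; hence the
  name. For a < 0 it is the exterior of a ball and for a = 0 a half-space, and keeping the form
  avoids this distinction.\<close>

definition circ_rad :: "real \<Rightarrow> real \<Rightarrow> real" where
  "circ_rad p t = (if t = 0 \<or> t = pi then p else sin (p * sin t) / sin t)"

lemma sin_pos_if_interior:
  fixes t :: real
  assumes "0 \<le> t" "t \<le> pi" "t \<noteq> 0" "t \<noteq> pi" shows "sin t > 0"
  using assms by (intro sin_gt_zero) auto

lemma DERIV_affine_exp:
  fixes p :: real
  shows "((\<lambda>p. (1 + p) * exp (- p)) has_real_derivative - exp (- p) * p) (at p)"
    and "((\<lambda>p. (1 - p) * exp p) has_real_derivative - exp p * p) (at p)"
  by (rule derivative_eq_intros refl | simp add: algebra_simps)+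

lemma DERIV_calE_quad_coeff:
  assumes "0 \<le> t" "t \<le> pi"
  shows "((\<lambda>p. calE_quad_coeff p t) has_real_derivative - exp (- p * cos t) * circ_rad p t) (at p)"
proof (cases "t = 0 \<or> t = pi")
  case True
  then show ?thesis
    using DERIV_affine_exp[of p] by (auto simp: calE_quad_coeff_def circ_rad_def)
next
  case False
  then have s: "sin t > 0" using sin_pos_if_interior assms by auto
  \<comment> \<open>Seen as a difference of these two angles, its sine is up to sign and the
    exponential factor the numerator of the derivative.\<close>
  have "sin (p * sin t) = sin ((t + p * sin t) - t)" by simp
  also have "\<dots> = sin (t + p * sin t) * cos t - cos (t + p * sin t) * sin t"
    by (rule sin_diff)
  finally have *: "sin (p * sin t) = sin (t + p * sin t) * cos t - cos (t + p * sin t) * sin t" .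
  have eq: "calE_quad_coeff p t = exp (- p * cos t) * sin (t + p * sin t) / sin t" for p
    using False by (simp add: calE_quad_coeff_def)
  have "((\<lambda>p. exp (- p * cos t) * sin (t + p * sin t) / sin t) has_real_derivative
      (exp (- p * cos t) * (- cos t) * sin (t + p * sin t)
        + exp (- p * cos t) * (cos (t + p * sin t) * sin t)) / sin t) (at p)"
    by (rule DERIV_cdivide) (auto intro!: derivative_eq_intros simp: algebra_simps)
  moreover have "(exp (- p * cos t) * (- cos t) * sin (t + p * sin t)
        + exp (- p * cos t) * (cos (t + p * sin t) * sin t)) / sin t
      = - exp (- p * cos t) * circ_rad p t"
    using False s unfolding circ_rad_def * by (simp add: field_simps)
  ultimately show ?thesis unfolding eq by simp
qed

lemma DERIV_calE_const_coeff:
  assumes "0 \<le> t" "t \<le> pi"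
  shows "((\<lambda>p. calE_const_coeff p t) has_real_derivative - exp (p * cos t) * circ_rad p t) (at p)"
proof (cases "t = 0 \<or> t = pi")
  case True
  then show ?thesis
    using DERIV_affine_exp[of p] by (auto simp: calE_const_coeff_def circ_rad_def)
next
  case False
  then have s: "sin t > 0" using sin_pos_if_interior assms by auto
  have "sin (p * sin t) = sin (t - (t - p * sin t))" by simp
  also have "\<dots> = sin t * cos (t - p * sin t) - cos t * sin (t - p * sin t)"
    by (rule sin_diff)
  finally have *: "sin (p * sin t) = sin t * cos (t - p * sin t) - cos t * sin (t - p * sin t)" .
  have eq: "calE_const_coeff p t = exp (p * cos t) * sin (t - p * sin t) / sin t" for p
    using False by (simp add: calE_const_coeff_def)
  have "((\<lambda>p. exp (p * cos t) * sin (t - p * sin t) / sin t) has_real_derivative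
      (exp (p * cos t) * cos t * sin (t - p * sin t)
        - exp (p * cos t) * (cos (t - p * sin t) * sin t)) / sin t) (at p)"
    by (rule DERIV_cdivide) (auto intro!: derivative_eq_intros simp: algebra_simps)
  moreover have "(exp (p * cos t) * cos t * sin (t - p * sin t)
        - exp (p * cos t) * (cos (t - p * sin t) * sin t)) / sin t
      = - exp (p * cos t) * circ_rad p t"
    using False s unfolding circ_rad_def * by (simp add: field_simps)
  ultimately show ?thesis unfolding eq by simp
qed

text \<open>The exponential factors of the two coefficients are inverse to each other, and sin (u +
  v) sin (u - v) = sin u ^ 2 - sin v ^ 2 gives the rest. The left-hand side is the discriminant of
  the form.\<close>

lemma circ_rad_sq:
  assumes "0 \<le> t" "t \<le> pi"
  shows "1 - calE_quad_coeff p t * calE_const_coeff p t = (circ_rad p t)\<^sup>2"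
proof (cases "t = 0 \<or> t = pi")
  case True
  have "exp p * exp (- p) = 1" for p :: real by (simp flip: exp_add)
  then have "(1 + p) * exp (- p) * ((1 - p) * exp p) = (1 + p) * (1 - p)"
    by (metis (no_types, opaque_lifting) mult.assoc mult.commute mult.right_neutral)
  moreover then have "(1 - p) * exp p * ((1 + p) * exp (- p)) = (1 + p) * (1 - p)"
    by (simp add: mult.commute)
  ultimately show ?thesis using True
    by (auto simp: calE_quad_coeff_def calE_const_coeff_def circ_rad_def power2_eq_square algebra_simps)
next
  case False
  then have s: "sin t > 0" using sin_pos_if_interior assms by auto
  have e: "exp (- p * cos t) * exp (p * cos t) = 1" by (simp flip: exp_add)
  have "sin (t + p * sin t) * sin (t - p * sin t)
      = (sin t)\<^sup>2 * (cos (p * sin t))\<^sup>2 - (cos t)\<^sup>2 * (sin (p * sin t))\<^sup>2"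
    by (simp add: sin_add sin_diff algebra_simps power2_eq_square)
  also have "\<dots> = (sin t)\<^sup>2 * (1 - (sin (p * sin t))\<^sup>2) - (1 - (sin t)\<^sup>2) * (sin (p * sin t))\<^sup>2"
    by (simp only: cos_squared_eq)
  also have "\<dots> = (sin t)\<^sup>2 - (sin (p * sin t))\<^sup>2" by (simp add: algebra_simps)
  finally have "sin (t + p * sin t) * sin (t - p * sin t) = (sin t)\<^sup>2 - (sin (p * sin t))\<^sup>2" .
  moreover have "calE_quad_coeff p t * calE_const_coeff p t =
     (exp (- p * cos t) * exp (p * cos t)) * (sin (t + p * sin t) * sin (t - p * sin t)) / (sin t)\<^sup>2"
    using False by (simp add: calE_quad_coeff_def calE_const_coeff_def power2_eq_square)
  ultimately show ?thesis using False s e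
    by (simp add: circ_rad_def power_divide diff_divide_distrib)
qed

text \<open>The angle p sin t stays strictly between 0 and pi; this is the origin of the bound pi /
  sin t on q.\<close>

lemma circ_rad_pos:
  assumes "0 \<le> t" "t \<le> pi" "0 < p" "p * sin t < pi"
  shows "0 < circ_rad p t"
  using assms sin_pos_if_interior[of t] by (auto simp: circ_rad_def intro!: divide_pos_pos sin_gt_zero)

lemma continuous_circ_rad: "continuous_on S (\<lambda>p. circ_rad p t)"
  unfolding circ_rad_def divide_inverse
  by (cases "t = 0 \<or> t = pi") (auto intro!: continuous_intros)

text \<open>A Gronwall argument from the last time c with \<open>0 \<le> F c\<close>: after c the
  product of F with exp (- C * r) cannot decrease. A sign condition on the derivative at zeros of F
  alone would not be enough, since F could cross zero with derivative 0.\<close>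

lemma nonneg_of_lower_derivative:
  fixes F F' :: "real \<Rightarrow> real"
  assumes ab: "a \<le> b" and F: "\<And>r. a \<le> r \<Longrightarrow> r \<le> b \<Longrightarrow> (F has_real_derivative F' r) (at r)"
    and neg: "\<And>r. a \<le> r \<Longrightarrow> r \<le> b \<Longrightarrow> F r < 0 \<Longrightarrow> C * F r \<le> F' r"
    and Fa: "0 \<le> F a"
  shows "0 \<le> F b"
proof (rule ccontr)
  assume "\<not> 0 \<le> F b"
  define G where "G r = F r * exp (- C * r)" for r
  have contF: "continuous_on {a..b} F"
    by (rule continuous_at_imp_continuous_on) (auto intro!: DERIV_isCont F)
  define S where "S = {a..b} \<inter> F -` {0..}"
  have "closed S" unfolding S_def by (rule continuous_closed_preimage[OF contF]) auto
  moreover have "S \<noteq> {}" "bdd_above S" using Fa ab by (auto simp: S_def bdd_above_def)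
  ultimately have sup: "Sup S \<in> S" using closed_contains_Sup by blast
  define c where "c = Sup S"
  have c: "a \<le> c" "c \<le> b" "0 \<le> F c" using sup by (auto simp: S_def c_def)
  with \<open>\<not> 0 \<le> F b\<close> have "c < b" by (cases "c = b") auto
  have after: "F r < 0" if "c < r" "r \<le> b" for r
  proof (rule ccontr)
    assume "\<not> F r < 0"
    then have "r \<in> S" using that c by (auto simp: S_def)
    then have "r \<le> c" unfolding c_def using \<open>bdd_above S\<close> by (rule cSup_upper)
    with that show False by simp
  qed
  have G: "(G has_real_derivative (F' r - C * F r) * exp (- C * r)) (at r)" if "a \<le> r" "r \<le> b" for r
    unfolding G_def by (auto intro!: derivative_eq_intros F that) (simp add: algebra_simps)
  have "\<exists>z. z > c \<and> z < b \<and> G b - G c = (b - c) * ((F' z - C * F z) * exp (- C * z))"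
    by (rule MVT2[OF \<open>c < b\<close>]) (rule G; use c in simp)
  then obtain z where z: "c < z" "z < b" "G b - G c = (b - c) * ((F' z - C * F z) * exp (- C * z))"
    by blast
  have "0 \<le> F' z - C * F z" using neg[of z] after[of z] z c by auto
  then have "0 \<le> G b - G c" unfolding z(3) using \<open>c < b\<close> by simp
  moreover have "0 \<le> G c" using c by (simp add: G_def)
  moreover have "G b < 0" using \<open>\<not> 0 \<le> F b\<close> by (simp add: G_def mult_less_0_iff)
  ultimately show False by simp
qed

text \<open>
  On the boundary of the region where the form is nonnegative, the gradient x - a y in y has length
  circ_rad p t times the norm of x, so by the arithmetic-geometric mean inequality no path with
  speed at most its norm can leave it; off the boundary the loss is linear in the defect.
\<close>

lemma qform_path:
  fixes z :: "real \<Rightarrow> 'a::real_inner"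
  assumes t: "0 \<le> t" "t \<le> pi" and p: "0 < p" "p \<le> q" "q * sin t < pi" and x: "x \<noteq> 0"
    and z: "\<And>r. p \<le> r \<Longrightarrow> r \<le> q \<Longrightarrow> (z has_vector_derivative z' r) (at r)"
    and speed: "\<And>r. p \<le> r \<Longrightarrow> r \<le> q \<Longrightarrow> norm (z' r) \<le> norm (z r)"
    and start: "0 \<le> qform p t x (z p)"
  shows "0 \<le> qform q t x (z q)"
proof -
  let ?a = "\<lambda>r. calE_quad_coeff r t" and ?c = "\<lambda>r. calE_const_coeff r t"
  let ?s = "\<lambda>r. circ_rad r t"
  define F where "F r = qform r t x (z r)" for r
  define F' where "F' r = exp (- r * cos t) * ?s r * (norm (z r))\<^sup>2 + exp (r * cos t) * ?s r * (norm x)\<^sup>2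
    + 2 * inner (z' r) (x - ?a r *\<^sub>R z r)" for r
  have sin_t: "0 \<le> sin t" using t by (rule sin_ge_zero)
  have s_pos: "0 < ?s r" if "p \<le> r" "r \<le> q" for r
  proof (rule circ_rad_pos[OF t])
    show "r * sin t < pi" using mult_right_mono[OF that(2) sin_t] p by linarith
  qed (use that p in auto)
  have cont_z: "continuous_on {p..q} z"
    by (rule continuous_at_imp_continuous_on)
      (auto intro: z[THEN has_vector_derivative_continuous])
  have cont_a: "continuous_on {p..q} ?a"
    by (rule continuous_at_imp_continuous_on)
      (auto intro: DERIV_calE_quad_coeff[OF t, THEN DERIV_isCont])
  \<comment> \<open>The factor of F in the derivative estimate below. It is continuous because the
    radius stays positive, so compactness yields one constant C for the whole interval.\<close>
  define h where "h r = norm (z r) * \<bar>?a r\<bar> / (?s r * norm x)" for r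
  have "continuous_on {p..q} h"
    unfolding h_def using x s_pos by (intro continuous_intros cont_z cont_a continuous_circ_rad) fastforce
  then have "bounded (h ` {p..q})"
    by (intro compact_imp_bounded compact_continuous_image) auto
  then obtain C where "\<forall>y\<in>h ` {p..q}. norm y \<le> C" unfolding bounded_iff by blast
  then have C: "norm (z r) * \<bar>?a r\<bar> / (?s r * norm x) \<le> C" if "p \<le> r" "r \<le> q" for r
    using that by (fastforce simp: h_def[symmetric] dest: abs_le_D1)
  have "0 \<le> F q"
  proof (rule nonneg_of_lower_derivative[of p q F F' C])
    fix r assume r: "p \<le> r" "r \<le> q"
    have dz: "(z has_derivative (\<lambda>h. h *\<^sub>R z' r)) (at r)"
      using z[OF r] by (simp add: has_vector_derivative_def)
    have dn: "((\<lambda>r. inner (z r) (z r)) has_real_derivative 2 * inner (z' r) (z r)) (at r)"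
      unfolding has_field_derivative_def
      by (rule has_derivative_eq_rhs[OF has_derivative_inner[OF dz dz]])
        (auto simp: inner_commute fun_eq_iff)
    have dx: "((\<lambda>r. inner x (z r)) has_real_derivative inner (z' r) x) (at r)"
      unfolding has_field_derivative_def
      by (rule has_derivative_eq_rhs[OF has_derivative_inner[OF has_derivative_const dz]])
        (auto simp: inner_commute fun_eq_iff)
    show "(F has_real_derivative F' r) (at r)"
      unfolding F_def[abs_def] qform_def power2_norm_eq_inner
      by (rule derivative_eq_intros dn dx DERIV_calE_quad_coeff[OF t] DERIV_calE_const_coeff[OF t] refl)+
        (simp add: F'_def power2_norm_eq_inner inner_diff_right algebra_simps)
    assume neg: "F r < 0"
    have sx: "0 < ?s r * norm x" using s_pos[OF r] x by simp
    \<comment> \<open>Expand the square and replace 1 - a c by the square of the radius; where F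
      vanishes, this is the length of the gradient on the boundary.\<close>
    have grad: "(norm (x - ?a r *\<^sub>R z r))\<^sup>2 = (?s r * norm x)\<^sup>2 - ?a r * F r"
      unfolding F_def qform_def power_mult_distrib circ_rad_sq[OF t, symmetric]
      by (simp add: power2_norm_eq_inner inner_diff_left inner_diff_right inner_commute algebra_simps)
    \<comment> \<open>The square root of m ^ 2 + d is at most m + d / (2 m), with m the boundary
      length and d = \<bar>a\<bar> (- F); the gradient thus exceeds m by an amount linear in the
      defect.\<close>
    have up: "norm (x - ?a r *\<^sub>R z r) \<le> ?s r * norm x + \<bar>?a r\<bar> / (2 * (?s r * norm x)) * (- F r)"
    proof (rule power2_le_imp_le)
      let ?m = "?s r * norm x" and ?e = "\<bar>?a r\<bar> / (2 * (?s r * norm x)) * (- F r)"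
      have "2 * ?m * ?e = \<bar>?a r\<bar> * (- F r)"
        using s_pos[OF r] x by (simp add: field_simps)
      moreover have "(u + v)\<^sup>2 = u\<^sup>2 + 2 * u * v + v\<^sup>2" for u v :: real by (simp add: power2_sum)
      note this[of ?m ?e]
      moreover have "- ?a r * F r \<le> \<bar>?a r\<bar> * (- F r)"
        using mult_right_mono[of "?a r" "\<bar>?a r\<bar>" "- F r"] neg by simp
      moreover have "0 \<le> ?e\<^sup>2" by simp
      ultimately show "(norm (x - ?a r *\<^sub>R z r))\<^sup>2 \<le> (?m + ?e)\<^sup>2" unfolding grad by linarith
      have "0 \<le> ?e" using neg s_pos[OF r] by (intro mult_nonneg_nonneg divide_nonneg_nonneg) auto
      with sx show "0 \<le> ?m + ?e" by linarith
    qed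
    have "\<bar>inner (z' r) (x - ?a r *\<^sub>R z r)\<bar> \<le> norm (z' r) * norm (x - ?a r *\<^sub>R z r)"
      by (rule Cauchy_Schwarz_ineq2)
    also have "\<dots> \<le> norm (z r) * (?s r * norm x + \<bar>?a r\<bar> / (2 * (?s r * norm x)) * (- F r))"
      using speed[OF r] up by (intro mult_mono) auto
    finally have cs: "- (norm (z r) * (?s r * norm x + \<bar>?a r\<bar> / (2 * (?s r * norm x)) * (- F r)))
      \<le> inner (z' r) (x - ?a r *\<^sub>R z r)" by linarith
    \<comment> \<open>The two weights have product 1, and their squares are the exponentials in the
      derivatives of the two coefficients.\<close>
    have amgm: "2 * norm (z r) * norm x \<le> exp (- r * cos t) * (norm (z r))\<^sup>2 + exp (r * cos t) * (norm x)\<^sup>2"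
    proof -
      let ?u = "exp (- r * cos t / 2) * norm (z r)" and ?v = "exp (r * cos t / 2) * norm x"
      have e: "(exp (- r * cos t / 2))\<^sup>2 = exp (- r * cos t)" "(exp (r * cos t / 2))\<^sup>2 = exp (r * cos t)"
        "exp (- r * cos t / 2) * exp (r * cos t / 2) = 1"
        by (simp_all flip: exp_of_nat_mult exp_add)
      have "?u * ?v = (exp (- r * cos t / 2) * exp (r * cos t / 2)) * (norm (z r) * norm x)"
        by (simp only: mult_ac)
      then have "?u * ?v = norm (z r) * norm x" by (simp only: e mult_1)
      moreover have "0 \<le> ?u\<^sup>2 + ?v\<^sup>2 - 2 * (?u * ?v)"
        using zero_le_power2[of "?u - ?v"] by (simp only: power2_diff mult.assoc)
      ultimately show ?thesis by (simp only: power_mult_distrib e)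
    qed
    have "C * F r \<le> norm (z r) * \<bar>?a r\<bar> / (?s r * norm x) * F r"
      using neg by (intro mult_right_mono_neg C[OF r]) simp
    \<comment> \<open>The terms without F cancel: the boundary part of the Cauchy-Schwarz loss is
      exactly what the arithmetic-geometric mean inequality pays for.\<close>
    also have "\<dots> = ?s r * (2 * norm (z r) * norm x)
        - 2 * (norm (z r) * (?s r * norm x + \<bar>?a r\<bar> / (2 * (?s r * norm x)) * (- F r)))"
      by (simp add: algebra_simps)
    also have "\<dots> \<le> ?s r * (exp (- r * cos t) * (norm (z r))\<^sup>2 + exp (r * cos t) * (norm x)\<^sup>2)
        + 2 * inner (z' r) (x - ?a r *\<^sub>R z r)"
      using cs mult_left_mono[OF amgm less_imp_le[OF s_pos[OF r]]] by linarith
    also have "\<dots> = F' r" by (simp add: F'_def algebra_simps)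
    finally show "C * F r \<le> F' r" .
  qed (use p start in \<open>auto simp: F_def\<close>)
  then show ?thesis by (simp add: F_def)
qed

text \<open>
  Move from y along the segment to y + d with speed exp (- s) times a constant at most norm y:
  after time s the norm is still at least exp (- s) norm y, so the speed never exceeds it.
\<close>

lemma qform_step:
  fixes x y d :: "'a::real_inner"
  assumes t: "0 \<le> t" "t \<le> pi" and p: "0 < p" "0 \<le> g" "(p + g) * sin t < pi" and x: "x \<noteq> 0"
    and d: "norm d \<le> (1 - exp (- g)) * norm y"
    and start: "0 \<le> qform p t x y"
  shows "0 \<le> qform (p + g) t x (y + d)"
proof -
  \<comment> \<open>The velocity is scaled so that time g covers exactly d. For g = 0 the bound on d
    forces d = 0, and division by zero gives e = 0, the resting path.\<close>
  define e where "e = d /\<^sub>R (1 - exp (- g))"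
  have ne: "norm e \<le> norm y"
  proof (cases "g = 0")
    case False
    then have "0 < 1 - exp (- g)" using p by simp
    then show ?thesis using d by (simp add: e_def field_simps)
  qed (simp add: e_def)
  have de: "(1 - exp (- g)) *\<^sub>R e = d"
    using d by (cases "g = 0") (auto simp: e_def)
  define z where "z r = y + (1 - exp (- (r - p))) *\<^sub>R e" for r
  have "0 \<le> qform (p + g) t x (z (p + g))"
  proof (rule qform_path[OF t p(1) _ p(3) x])
    show "(z has_vector_derivative exp (- (r - p)) *\<^sub>R e) (at r)" for r
      unfolding z_def by (auto intro!: derivative_eq_intros)
    show "norm (exp (- (r - p)) *\<^sub>R e) \<le> norm (z r)" if "p \<le> r" for r
    proof -
      have le: "exp (- (r - p)) \<le> 1" using that by simp
      have "norm y - (1 - exp (- (r - p))) * norm e \<le> norm (z r)"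
        using norm_diff_ineq[of y "(1 - exp (- (r - p))) *\<^sub>R e"] le by (simp add: z_def)
      moreover have "(1 - exp (- (r - p))) * norm e \<le> (1 - exp (- (r - p))) * norm y"
        "exp (- (r - p)) * norm e \<le> exp (- (r - p)) * norm y"
        using ne le by (auto intro!: mult_left_mono)
      ultimately show ?thesis by (simp add: algebra_simps)
    qed
  qed (use p start in \<open>auto simp: z_def\<close>)
  then show ?thesis by (simp add: z_def de)
qed

section \<open>Extreme parameters and small shifts of the parameter\<close>

lemma qform_0:
  assumes "0 \<le> t" "t \<le> pi" shows "qform 0 t x y = - (norm (y - x))\<^sup>2"
proof -
  have "calE_quad_coeff 0 t = 1" "calE_const_coeff 0 t = 1"
    using sin_pos_if_interior[OF assms]
    by (cases "t = 0"; cases "t = pi"; simp add: calE_quad_coeff_def calE_const_coeff_def)+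
  then show ?thesis
    by (simp add: qform_def power2_norm_eq_inner inner_diff_left inner_diff_right inner_commute)
qed

lemma qform_same:
  assumes t: "0 \<le> t" "t \<le> pi" and e: "0 \<le> e" "e * sin t < pi"
  shows "0 \<le> qform e t x x"
proof -
  have "0 \<le> sin t" using t by (rule sin_ge_zero)
  have nn: "0 \<le> circ_rad r t" if "0 \<le> r" "r \<le> e" for r
  proof (cases "r = 0")
    case False
    then show ?thesis
      using that e mult_right_mono[OF that(2) \<open>0 \<le> sin t\<close>] by (intro less_imp_le[OF circ_rad_pos[OF t]]) auto
  qed (simp add: circ_rad_def)
  let ?f = "\<lambda>r. calE_quad_coeff r t + calE_const_coeff r t"
  have "?f e \<le> ?f 0"
  proof (rule DERIV_nonpos_imp_nonincreasing[OF e(1)])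
    fix r assume "0 \<le> r" "r \<le> e"
    then have "0 \<le> (exp (- r * cos t) + exp (r * cos t)) * circ_rad r t"
      by (intro mult_nonneg_nonneg nn add_nonneg_nonneg) auto
    moreover have "(?f has_real_derivative
        - exp (- r * cos t) * circ_rad r t + - exp (r * cos t) * circ_rad r t) (at r)"
      by (intro DERIV_add DERIV_calE_quad_coeff DERIV_calE_const_coeff t)
    ultimately show "\<exists>y. (?f has_real_derivative y) (at r) \<and> y \<le> 0"
      by (intro exI conjI) (assumption, simp add: algebra_simps)
  qed
  also have "?f 0 = 2"
    using sin_pos_if_interior[OF t]
    by (cases "t = 0"; cases "t = pi"; simp add: calE_quad_coeff_def calE_const_coeff_def)
  finally have "0 \<le> (2 - ?f e) * (norm x)\<^sup>2" by simp
  then show ?thesis by (simp add: qform_def power2_norm_eq_inner algebra_simps)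
qed

text \<open>A shift by pi inside the sine makes both coefficients negative exponentials, and the
  form becomes the perfect square \<open>(norm (?u + ?v))\<^sup>2\<close>.\<close>

lemma qform_extreme:
  assumes "sin t \<noteq> 0" "t \<noteq> 0" "t \<noteq> pi" "p * sin t = pi"
  shows "0 \<le> qform p t x y"
proof -
  let ?u = "exp (- p * cos t / 2) *\<^sub>R y" and ?v = "exp (p * cos t / 2) *\<^sub>R x"
  have ac: "calE_quad_coeff p t = - exp (- p * cos t)" "calE_const_coeff p t = - exp (p * cos t)"
    using assms by (auto simp: calE_quad_coeff_def calE_const_coeff_def)
  have "(exp (- p * cos t / 2))\<^sup>2 = exp (- p * cos t)" "(exp (p * cos t / 2))\<^sup>2 = exp (p * cos t)"
    by (simp_all flip: exp_of_nat_mult)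
  moreover have "exp (- p * cos t / 2) * exp (p * cos t / 2) = 1"
    by (simp flip: exp_add)
  moreover have "inner ?u ?v = (exp (- p * cos t / 2) * exp (p * cos t / 2)) * inner x y"
    by (simp add: inner_commute)
  moreover have "(norm (?u + ?v))\<^sup>2
      = (exp (- p * cos t / 2))\<^sup>2 * (norm y)\<^sup>2 + 2 * inner ?u ?v + (exp (p * cos t / 2))\<^sup>2 * (norm x)\<^sup>2"
    unfolding power2_norm_eq_inner
    by (simp add: inner_add_left inner_add_right inner_commute power2_eq_square)
  ultimately have "(norm (?u + ?v))\<^sup>2 = qform p t x y"
    unfolding qform_def ac by simp
  then show ?thesis by (metis zero_le_power2)
qed

text \<open>For p > 0 this is a step with d = 0, a path at rest. At p = 0 the region is the single
  point y = x, where the path argument has no room to start, so that case is computed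
  directly.\<close>

lemma qform_pos_shift:
  fixes x y :: "'a::real_inner"
  assumes t: "0 \<le> t" "t \<le> pi" and p: "0 \<le> p" "0 < e" "(p + e) * sin t < pi" and x: "x \<noteq> 0"
    and start: "0 \<le> qform p t x y"
  shows "0 \<le> qform (p + e) t x y"
proof (cases "p = 0")
  case True
  then have "y = x" using start by (simp add: qform_0[OF t])
  then show ?thesis using qform_same[OF t, of e x] True p by simp
next
  case False
  then show ?thesis using qform_step[OF t _ _ p(3) x, of 0 y] start p by simp
qed

lemma isCont_qform:
  assumes "0 \<le> t" "t \<le> pi"
  shows "isCont (\<lambda>p. qform p t x y) p"
  unfolding qform_def
  by (intro continuous_intros DERIV_calE_quad_coeff[OF assms, THEN DERIV_isCont]
      DERIV_calE_const_coeff[OF assms, THEN DERIV_isCont])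

section \<open>Variation of an ordered measure\<close>

lemma ordered_measure_empty:
  assumes "ordered_measure I \<phi>" shows "\<phi> {} = 0"
proof -
  have "\<forall>E::nat \<Rightarrow> real set. (\<forall>n. E n \<in> sets borel \<and> E n \<subseteq> I) \<longrightarrow> disjoint_family E \<longrightarrow>
        (\<lambda>n. \<phi> (E n)) sums \<phi> (\<Union>n. E n)"
    using assms by (simp add: ordered_measure_def)
  from this[rule_format, of "\<lambda>_. {}"]
  have "(\<lambda>n::nat. \<phi> {}) sums \<phi> {}" by (simp add: disjoint_family_on_def)
  then have "(\<lambda>n::nat. \<phi> {}) \<longlonglongrightarrow> 0" by (intro summable_LIMSEQ_zero sums_summable)
  then show ?thesis by (simp add: LIMSEQ_const_iff)
qed

lemma ordered_measure_sums:
  fixes E :: "nat \<Rightarrow> real set"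
  assumes "ordered_measure I \<phi>" "\<And>n. E n \<in> sets borel" "\<And>n. E n \<subseteq> I" "disjoint_family E"
  shows "(\<lambda>n. \<phi> (E n)) sums \<phi> (\<Union>n. E n)"
  using assms by (simp add: ordered_measure_def)

lemma ordered_measure_Un:
  assumes om: "ordered_measure I \<phi>"
    and "A \<in> sets borel" "A \<subseteq> I" "B \<in> sets borel" "B \<subseteq> I" "A \<inter> B = {}"
  shows "\<phi> (A \<union> B) = \<phi> A + \<phi> B"
proof -
  have "(\<lambda>n. \<phi> (binaryset A B n)) sums \<phi> (\<Union>n. binaryset A B n)"
    using assms by (intro ordered_measure_sums[OF om])
      (auto simp: binaryset_def disjoint_family_on_def)
  moreover have "(\<lambda>n. \<phi> (binaryset A B n)) sums (\<phi> A + \<phi> B)"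
    by (rule binaryset_sums[where f = \<phi>, OF ordered_measure_empty[OF om]])
  ultimately show ?thesis by (simp add: UN_binaryset_eq sums_unique2)
qed

lemma ordered_measure_finite_Union:
  assumes om: "ordered_measure I \<phi>" and "finite K"
    and "\<And>k. k \<in> K \<Longrightarrow> A k \<in> sets borel" "\<And>k. k \<in> K \<Longrightarrow> A k \<subseteq> I" "disjoint_family_on A K"
  shows "\<phi> (\<Union>k\<in>K. A k) = (\<Sum>k\<in>K. \<phi> (A k))"
  using assms(2-)
proof (induction K)
  case (insert k K)
  have "\<phi> (A k \<union> (\<Union>j\<in>K. A j)) = \<phi> (A k) + \<phi> (\<Union>j\<in>K. A j)"
    using insert.hyps insert.prems
    by (intro ordered_measure_Un[OF om] sets.finite_UN) (auto simp: disjoint_family_on_def)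
  moreover have "\<phi> (\<Union>j\<in>K. A j) = (\<Sum>j\<in>K. \<phi> (A j))"
    using insert.prems by (intro insert.IH) (auto simp: disjoint_family_on_def)
  ultimately show ?case using insert.hyps by simp
qed (simp add: ordered_measure_empty[OF om])

text \<open>\<open>variation\<close> takes suprema over sets of cells, whereas an indexed family may
  repeat a cell. By disjointness only the empty cell can be repeated, and it contributes
  nothing.\<close>

lemma variation_ge_sum:
  assumes "finite K" "\<And>k. k \<in> K \<Longrightarrow> A k \<in> sets borel" "disjoint_family_on A K"
    and "(\<Union>k\<in>K. A k) = E" and e: "\<phi> {} = 0"
  shows "(\<Sum>k\<in>K. ennreal (norm (\<phi> (A k)))) \<le> variation \<phi> E"
proof -
  let ?f = "\<lambda>A. ennreal (norm (\<phi> A))"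
  have "(\<Sum>k\<in>K. ?f (A k)) = (\<Sum>X\<in>A ` K. ?f X)"
  proof (subst sum.reindex_nontrivial)
    show "?f (A x) = 0" if "x \<in> K" "y \<in> K" "x \<noteq> y" "A x = A y" for x y
    proof -
      have "A x = {}" using that assms(3) by (auto simp: disjoint_family_on_def)
      then show ?thesis using e by simp
    qed
  qed (use assms in auto)
  also have "\<dots> \<le> variation \<phi> E"
    unfolding variation_def
    using assms disjoint_family_on_disjoint_image[OF assms(3)] by (intro SUP_upper) auto
  finally show ?thesis .
qed

lemma variation_superadd:
  assumes e: "\<phi> {} = 0" and "A \<inter> B = {}" "A \<in> sets borel" "B \<in> sets borel"
  shows "variation \<phi> A + variation \<phi> B \<le> variation \<phi> (A \<union> B)"
proof -
  let ?f = "\<lambda>A. ennreal (norm (\<phi> A))"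
  let ?P = "\<lambda>E. {P. finite P \<and> P \<subseteq> sets borel \<and> disjoint P \<and> \<Union>P = E}"
  have le: "sum ?f P + sum ?f Q \<le> variation \<phi> (A \<union> B)" if P: "P \<in> ?P A" and Q: "Q \<in> ?P B" for P Q
  proof -
    \<comment> \<open>Partitions of disjoint sets can share only the empty cell, so nothing is lost
      in forming their union.\<close>
    have "P \<inter> Q \<subseteq> {{}}" using P Q assms(2) by blast
    then have "sum ?f (P \<inter> Q) = 0" using e by (intro sum.neutral) auto
    moreover have "sum ?f (P \<union> Q) + sum ?f (P \<inter> Q) = sum ?f P + sum ?f Q"
      using P Q by (intro sum.union_inter) auto
    moreover have "disjoint (P \<union> Q)" using P Q assms(2) by (intro disjoint_union) auto
    then have "sum ?f (P \<union> Q) \<le> variation \<phi> (A \<union> B)"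
      unfolding variation_def using P Q by (intro SUP_upper) auto
    ultimately show ?thesis by simp
  qed
  have ne: "?P E \<noteq> {}" if "E \<in> sets borel" for E
  proof -
    have "{E} \<in> ?P E" using that by (auto simp: disjoint_def)
    then show ?thesis by (rule ex_in_conv[THEN iffD1, OF exI])
  qed
  have "variation \<phi> A + sum ?f Q \<le> variation \<phi> (A \<union> B)" if "Q \<in> ?P B" for Q
    unfolding variation_def[of \<phi> A] ennreal_SUP_add_left[OF ne[OF assms(3)], symmetric]
    using that by (intro SUP_least le) auto
  then show ?thesis
    unfolding variation_def[of \<phi> B] ennreal_SUP_add_right[OF ne[OF assms(4)]]
    by (intro SUP_least)
qed

text \<open>For the upper bound every cell of a partition of the union is cut along A and B;
  additivity of the measure and the triangle inequality show that cutting does not decrease the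
  sum.\<close>

lemma variation_Un:
  assumes om: "ordered_measure I \<phi>"
    and A: "A \<in> sets borel" "A \<subseteq> I" and B: "B \<in> sets borel" "B \<subseteq> I" and "A \<inter> B = {}"
  shows "variation \<phi> (A \<union> B) = variation \<phi> A + variation \<phi> B"
proof (rule antisym)
  note e = ordered_measure_empty[OF om]
  show "variation \<phi> A + variation \<phi> B \<le> variation \<phi> (A \<union> B)"
    using assms by (intro variation_superadd e) auto
  show "variation \<phi> (A \<union> B) \<le> variation \<phi> A + variation \<phi> B"
    unfolding variation_def[of \<phi> "A \<union> B"]
  proof (rule SUP_least)
    fix P assume "P \<in> {P. finite P \<and> P \<subseteq> sets borel \<and> disjoint P \<and> \<Union>P = A \<union> B}"
    then have P: "finite P" "P \<subseteq> sets borel" "disjoint P" "\<Union>P = A \<union> B" by auto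
    have "norm (\<phi> X) \<le> norm (\<phi> (X \<inter> A)) + norm (\<phi> (X \<inter> B))" if "X \<in> P" for X
    proof -
      have "X \<in> sets borel" using P that by auto
      then have "\<phi> (X \<inter> A \<union> X \<inter> B) = \<phi> (X \<inter> A) + \<phi> (X \<inter> B)"
        using A B assms(6) by (intro ordered_measure_Un[OF om] sets.Int) auto
      moreover have "X \<inter> A \<union> X \<inter> B = X" using P that by auto
      ultimately show ?thesis by (simp add: norm_triangle_ineq)
    qed
    then have "(\<Sum>X\<in>P. ennreal (norm (\<phi> X)))
        \<le> (\<Sum>X\<in>P. ennreal (norm (\<phi> (X \<inter> A))) + ennreal (norm (\<phi> (X \<inter> B))))"
      by (intro sum_mono) (simp flip: ennreal_plus)
    also have "\<dots> \<le> variation \<phi> A + variation \<phi> B"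
      unfolding sum.distrib
    proof (rule add_mono)
      have disj: "disjoint_family_on (\<lambda>X. X \<inter> C) P" for C
        using P(3) by (auto simp: disjoint_family_on_def disjoint_def)
      have un: "(\<Union>X\<in>P. X \<inter> A) = A" "(\<Union>X\<in>P. X \<inter> B) = B" using P(4) by auto
      have meas: "X \<inter> A \<in> sets borel" "X \<inter> B \<in> sets borel" if "X \<in> P" for X
        using that P(2) A(1) B(1) by auto
      show "(\<Sum>X\<in>P. ennreal (norm (\<phi> (X \<inter> A)))) \<le> variation \<phi> A"
        by (rule variation_ge_sum[of P "\<lambda>X. X \<inter> A" A \<phi>]) (fact P(1) meas disj un e)+
      show "(\<Sum>X\<in>P. ennreal (norm (\<phi> (X \<inter> B)))) \<le> variation \<phi> B"
        by (rule variation_ge_sum[of P "\<lambda>X. X \<inter> B" B \<phi>]) (fact P(1) meas disj un e)+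
    qed
    finally show "(\<Sum>X\<in>P. ennreal (norm (\<phi> X))) \<le> variation \<phi> A + variation \<phi> B" .
  qed
qed

lemma variation_mono:
  assumes om: "ordered_measure I \<phi>" and "A \<in> sets borel" "B \<in> sets borel" "A \<subseteq> B" "B \<subseteq> I"
  shows "variation \<phi> A \<le> variation \<phi> B"
proof -
  have "variation \<phi> (A \<union> (B - A)) = variation \<phi> A + variation \<phi> (B - A)"
    using assms by (intro variation_Un[OF om]) auto
  moreover have "A \<union> (B - A) = B" using assms by auto
  ultimately show ?thesis by simp
qed

lemma ordered_measure_borel: "ordered_measure I \<phi> \<Longrightarrow> I \<in> sets borel"
  by (auto simp: ordered_measure_def intro: real_interval_borel_measurable)

lemma ordered_measure_subset:
  assumes om: "ordered_measure I \<phi>" and J: "is_interval J" "J \<subseteq> I"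
  shows "ordered_measure J \<phi>"
proof -
  have "variation \<phi> J \<le> variation \<phi> I"
    using J by (intro variation_mono[OF om]) (auto intro: real_interval_borel_measurable ordered_measure_borel[OF om])
  also have "\<dots> < \<infinity>" using om by (simp add: ordered_measure_def)
  finally have "variation \<phi> J < \<infinity>" .
  then show ?thesis
    unfolding ordered_measure_def
  proof (intro conjI allI impI)
    show "(\<lambda>n. \<phi> (E n)) sums \<phi> (\<Union>n. E n)"
      if "\<forall>n. E n \<in> sets borel \<and> E n \<subseteq> J" "disjoint_family E" for E :: "nat \<Rightarrow> real set"
      using that J by (intro ordered_measure_sums[OF om]) auto
    have "\<forall>E. E \<in> sets borel \<longrightarrow> E \<subseteq> I \<longrightarrow> 0 < variation \<phi> E \<longrightarrow>
        (\<exists>F. F \<in> sets borel \<and> F \<subseteq> E \<and> 0 < variation \<phi> F \<and> variation \<phi> F < variation \<phi> E)"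
      using om by (simp add: ordered_measure_def)
    then show "\<exists>F. F \<in> sets borel \<and> F \<subseteq> E \<and> 0 < variation \<phi> F \<and> variation \<phi> F < variation \<phi> E"
      if "E \<in> sets borel" "E \<subseteq> J" "0 < variation \<phi> E" for E
      using that J(2) by (meson subset_trans)
  qed (use J in auto)
qed

text \<open>\<open>enn2real\<close> sends infinity to 0, so this is faithful where the variation is
  finite, as on Borel subsets of the interval of an ordered measure.\<close>

definition tvar :: "(real set \<Rightarrow> 'b::real_normed_vector) \<Rightarrow> real set \<Rightarrow> real" where
  "tvar \<phi> E = enn2real (variation \<phi> E)"

lemma tvar_nonneg [simp]: "0 \<le> tvar \<phi> E"
  by (simp add: tvar_def)

lemma variation_eq_tvar:
  assumes om: "ordered_measure I \<phi>" and "A \<in> sets borel" "A \<subseteq> I"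
  shows "variation \<phi> A = ennreal (tvar \<phi> A)"
proof -
  have "variation \<phi> A \<le> variation \<phi> I"
    using assms by (intro variation_mono[OF om] ordered_measure_borel[OF om]) auto
  also have "\<dots> < \<infinity>" using om by (simp add: ordered_measure_def)
  finally show ?thesis by (simp add: tvar_def)
qed

lemma tvar_Un:
  assumes om: "ordered_measure I \<phi>"
    and "A \<in> sets borel" "A \<subseteq> I" "B \<in> sets borel" "B \<subseteq> I" "A \<inter> B = {}"
  shows "tvar \<phi> (A \<union> B) = tvar \<phi> A + tvar \<phi> B"
proof -
  have "ennreal (tvar \<phi> (A \<union> B)) = ennreal (tvar \<phi> A + tvar \<phi> B)"
    using variation_Un[OF assms] assms by (simp add: variation_eq_tvar[OF om])
  then show ?thesis by (subst (asm) ennreal_inj) auto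
qed

lemma tvar_mono:
  assumes om: "ordered_measure I \<phi>" and "A \<in> sets borel" "B \<in> sets borel" "A \<subseteq> B" "B \<subseteq> I"
  shows "tvar \<phi> A \<le> tvar \<phi> B"
proof -
  have "A \<subseteq> I" using assms by blast
  then have "ennreal (tvar \<phi> A) \<le> ennreal (tvar \<phi> B)"
    using variation_mono[OF assms] assms by (simp add: variation_eq_tvar[OF om])
  then show ?thesis by simp
qed

lemma tvar_Diff:
  assumes om: "ordered_measure I \<phi>" and "A \<in> sets borel" "B \<in> sets borel" "A \<subseteq> B" "B \<subseteq> I"
  shows "tvar \<phi> (B - A) = tvar \<phi> B - tvar \<phi> A"
proof -
  have "tvar \<phi> (A \<union> (B - A)) = tvar \<phi> A + tvar \<phi> (B - A)"
    using assms by (intro tvar_Un[OF om]) auto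
  moreover have "A \<union> (B - A) = B" using assms by auto
  ultimately show ?thesis by simp
qed

lemma tvar_empty [simp]: "ordered_measure I \<phi> \<Longrightarrow> tvar \<phi> {} = 0"
  using tvar_Un[of I \<phi> "{}" "{}"] by simp

lemma sum_norm_le_tvar:
  assumes om: "ordered_measure I \<phi>" and "finite K" "\<And>k. k \<in> K \<Longrightarrow> A k \<in> sets borel"
    and "disjoint_family_on A K" "(\<Union>k\<in>K. A k) = E" "E \<subseteq> I"
  shows "(\<Sum>k\<in>K. norm (\<phi> (A k))) \<le> tvar \<phi> E"
proof -
  have "E \<in> sets borel" using assms by auto
  then have "ennreal (\<Sum>k\<in>K. norm (\<phi> (A k))) \<le> ennreal (tvar \<phi> E)"
    using variation_ge_sum[of K A E \<phi>, OF assms(2-5) ordered_measure_empty[OF om]] assms(6)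
    by (simp add: variation_eq_tvar[OF om] sum_ennreal)
  then show ?thesis by simp
qed

text \<open>The differences of consecutive sets partition \<open>E 0\<close>, and their sums
  telescope to \<phi> (E 0) - \<phi> (E n).\<close>

lemma ordered_measure_decseq:
  fixes E :: "nat \<Rightarrow> real set"
  assumes om: "ordered_measure I \<phi>" and E: "\<And>n. E n \<in> sets borel" "\<And>n. E n \<subseteq> I"
    and dec: "decseq E" "(\<Inter>n. E n) = {}"
  shows "(\<lambda>n. \<phi> (E n)) \<longlonglongrightarrow> 0"
proof -
  define D where "D n = E n - E (Suc n)" for n
  have sub: "E n \<subseteq> E m" if "m \<le> n" for m n using dec(1) that by (auto simp: decseq_def)
  have D: "D n \<in> sets borel" "D n \<subseteq> I" for n using E by (auto simp: D_def)
  have disj: "disjoint_family D"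
  proof -
    have "D m \<inter> D n = {}" if "m < n" for m n using sub[of "Suc m" n] that by (auto simp: D_def)
    then show ?thesis unfolding disjoint_family_on_def by (metis inf_commute linorder_neqE_nat)
  qed
  have UN: "(\<Union>n. D n) = E 0"
  proof
    show "(\<Union>n. D n) \<subseteq> E 0" using sub[of 0] by (auto simp: D_def)
    show "E 0 \<subseteq> (\<Union>n. D n)"
    proof
      fix x assume x: "x \<in> E 0"
      obtain n where "x \<notin> E n" using dec(2) by auto
      define m where "m = (LEAST n. x \<notin> E n)"
      have m: "x \<notin> E m" unfolding m_def using \<open>x \<notin> E n\<close> by (rule LeastI)
      then obtain k where k: "m = Suc k" using x by (cases m) auto
      then have "x \<in> E k" using not_less_Least[of k "\<lambda>n. x \<notin> E n"] by (auto simp: m_def)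
      then show "x \<in> (\<Union>n. D n)" using m k by (auto simp: D_def)
    qed
  qed
  have "(\<lambda>n. \<phi> (D n)) sums \<phi> (E 0)"
    using ordered_measure_sums[OF om D disj] by (simp add: UN)
  moreover have "(\<Sum>i<n. \<phi> (D i)) = \<phi> (E 0) - \<phi> (E n)" for n
  proof (induction n)
    case (Suc n)
    have "\<phi> (D n \<union> E (Suc n)) = \<phi> (D n) + \<phi> (E (Suc n))"
      using D E by (intro ordered_measure_Un[OF om]) (auto simp: D_def)
    moreover have "D n \<union> E (Suc n) = E n" using sub[of n "Suc n"] by (auto simp: D_def)
    ultimately show ?case using Suc by simp
  qed simp
  ultimately have "(\<lambda>n. \<phi> (E 0) - \<phi> (E n)) \<longlonglongrightarrow> \<phi> (E 0)" by (simp add: sums_def)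
  then have "(\<lambda>n. \<phi> (E 0) - (\<phi> (E 0) - \<phi> (E n))) \<longlonglongrightarrow> \<phi> (E 0) - \<phi> (E 0)"
    by (intro tendsto_diff tendsto_const)
  then show ?thesis by simp
qed

text \<open>
  A partition of E 0 that nearly attains the variation still does so after removing E n for large
  n, because the measure itself is continuous at the empty set; superadditivity then leaves little
  variation for E n.
\<close>

lemma tvar_decseq:
  fixes E :: "nat \<Rightarrow> real set"
  assumes om: "ordered_measure I \<phi>" and E: "\<And>n. E n \<in> sets borel" "\<And>n. E n \<subseteq> I"
    and dec: "decseq E" "(\<Inter>n. E n) = {}" and "0 < e"
  shows "\<exists>n. tvar \<phi> (E n) < e"
proof -
  let ?f = "\<lambda>A. ennreal (norm (\<phi> A))"
  have v0: "variation \<phi> (E 0) = ennreal (tvar \<phi> (E 0))"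
    using E by (intro variation_eq_tvar[OF om])
  have "\<exists>P. finite P \<and> P \<subseteq> sets borel \<and> disjoint P \<and> \<Union>P = E 0 \<and> tvar \<phi> (E 0) - e / 2 < (\<Sum>X\<in>P. norm (\<phi> X))"
  proof (cases "tvar \<phi> (E 0) - e / 2 < 0")
    \<comment> \<open>\<open>ennreal\<close> would truncate a negative threshold to 0; here the
      partition into one cell already exceeds it.\<close>
    case True
    then have "tvar \<phi> (E 0) - e / 2 < norm (\<phi> (E 0))"
      using norm_ge_zero[of "\<phi> (E 0)"] by linarith
    then show ?thesis using E by (intro exI[of _ "{E 0}"]) (auto simp: disjoint_def)
  next
    case False
    then have "ennreal (tvar \<phi> (E 0) - e / 2) < variation \<phi> (E 0)"
      unfolding v0 using \<open>0 < e\<close> by (intro ennreal_lessI) auto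
    then obtain P where "finite P" "P \<subseteq> sets borel" "disjoint P" "\<Union>P = E 0"
      "ennreal (tvar \<phi> (E 0) - e / 2) < (\<Sum>X\<in>P. ?f X)"
      unfolding variation_def less_SUP_iff by auto
    moreover from this have "tvar \<phi> (E 0) - e / 2 < (\<Sum>X\<in>P. norm (\<phi> X))"
      using False by (simp add: sum_ennreal ennreal_less_iff)
    ultimately show ?thesis by blast
  qed
  then obtain P where P: "finite P" "P \<subseteq> sets borel" "disjoint P" "\<Union>P = E 0"
    and big: "tvar \<phi> (E 0) - e / 2 < (\<Sum>X\<in>P. norm (\<phi> X))" by blast
  have "(\<lambda>n. \<phi> (X \<inter> E n)) \<longlonglongrightarrow> 0" if "X \<in> P" for X
    using that P E dec by (intro ordered_measure_decseq[OF om]) (auto simp: decseq_def, blast+)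
  moreover have "\<phi> (X - E n) = \<phi> X - \<phi> (X \<inter> E n)" if "X \<in> P" for X n
  proof -
    have "\<phi> ((X - E n) \<union> (X \<inter> E n)) = \<phi> (X - E n) + \<phi> (X \<inter> E n)"
      using that P E(1)[of n] E(2)[of 0] by (intro ordered_measure_Un[OF om]) auto
    then show ?thesis by (simp add: Un_Diff_Int)
  qed
  ultimately have "(\<lambda>n. \<phi> (X - E n)) \<longlonglongrightarrow> \<phi> X" if "X \<in> P" for X
    using that tendsto_diff[OF tendsto_const[of "\<phi> X"], of "\<lambda>n. \<phi> (X \<inter> E n)" 0] by simp
  then have "(\<lambda>n. \<Sum>X\<in>P. norm (\<phi> (X - E n))) \<longlonglongrightarrow> (\<Sum>X\<in>P. norm (\<phi> X))"
    by (intro tendsto_sum tendsto_norm) simp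
  then have "\<forall>\<^sub>F n in sequentially. tvar \<phi> (E 0) - e / 2 < (\<Sum>X\<in>P. norm (\<phi> (X - E n)))"
    using big by (rule order_tendstoD)
  then obtain n where n: "tvar \<phi> (E 0) - e / 2 < (\<Sum>X\<in>P. norm (\<phi> (X - E n)))"
    by (meson eventually_sequentially order_refl)
  have sub: "E n \<subseteq> E 0" using dec(1) by (simp add: decseq_def)
  have "(\<Sum>X\<in>P. norm (\<phi> (X - E n))) \<le> tvar \<phi> (E 0 - E n)"
    using P E(1)[of n] E(2)[of 0] by (intro sum_norm_le_tvar[OF om]) (auto simp: disjoint_family_on_def disjoint_def)
  also have "\<dots> = tvar \<phi> (E 0) - tvar \<phi> (E n)"
    using E sub by (intro tvar_Diff[OF om]) auto
  finally have "tvar \<phi> (E n) < e" using n \<open>0 < e\<close> by linarith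
  then show ?thesis ..
qed

text \<open>A point of positive variation would be an atom: its only subsets are the empty set and
  itself, and neither has a variation strictly in between.\<close>

lemma tvar_singleton:
  assumes om: "ordered_measure I \<phi>" and "x \<in> I"
  shows "tvar \<phi> {x} = 0"
proof (rule ccontr)
  assume "tvar \<phi> {x} \<noteq> 0"
  then have "0 < tvar \<phi> {x}" by (simp add: less_le)
  then have "0 < variation \<phi> {x}" using assms by (simp add: variation_eq_tvar[OF om])
  moreover have "\<forall>E. E \<in> sets borel \<longrightarrow> E \<subseteq> I \<longrightarrow> 0 < variation \<phi> E \<longrightarrow>
        (\<exists>F. F \<in> sets borel \<and> F \<subseteq> E \<and> 0 < variation \<phi> F \<and> variation \<phi> F < variation \<phi> E)"
    using om by (simp add: ordered_measure_def)
  ultimately obtain F where F: "F \<subseteq> {x}" "0 < variation \<phi> F" "variation \<phi> F < variation \<phi> {x}"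
    using assms(2) by (elim allE[of _ "{x}"]) auto
  then consider "F = {}" | "F = {x}" by blast
  moreover have "variation \<phi> {} = 0" using om by (simp add: variation_eq_tvar[OF om])
  ultimately show False using F by cases auto
qed

section \<open>Initial segments of an interval and intermediate values of the variation\<close>

definition initial_segment :: "real set \<Rightarrow> real set \<Rightarrow> bool" where
  "initial_segment D J \<longleftrightarrow> D \<subseteq> J \<and> (\<forall>x\<in>D. \<forall>y\<in>J. y \<le> x \<longrightarrow> y \<in> D)"

lemma initial_segment_ordered_measure:
  assumes om: "ordered_measure J \<phi>" and D: "initial_segment D J"
  shows "ordered_measure D \<phi>"
proof (rule ordered_measure_subset[OF om])
  have "is_interval J" using om by (simp add: ordered_measure_def)
  then show "is_interval D" using D unfolding initial_segment_def is_interval_1 by blast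
qed (use D in \<open>simp add: initial_segment_def\<close>)

lemma initial_segment_atMost: "initial_segment (J \<inter> {..s}) J"
  by (auto simp: initial_segment_def)

text \<open>Punctured windows around s decrease to the empty set and s itself carries no variation,
  so some window has variation below e; it contains every increment between cuts close to s.\<close>

lemma isCont_tvar_atMost:
  assumes om: "ordered_measure J \<phi>"
  shows "isCont (\<lambda>s. tvar \<phi> (J \<inter> {..s})) s"
proof -
  note J = ordered_measure_borel[OF om]
  have "\<exists>d>0. \<forall>r. \<bar>r - s\<bar> < d \<longrightarrow> \<bar>tvar \<phi> (J \<inter> {..r}) - tvar \<phi> (J \<inter> {..s})\<bar> < e" if "0 < e" for e
  proof -
    define h where "h n = 1 / real (Suc n)" for n
    define E where "E n = J \<inter> {s - h n<..s + h n} - {s}" for n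
    have "h n \<le> h m" if "m \<le> n" for m n
      using that by (simp add: h_def divide_simps)
    then have "E n \<subseteq> E m" if "m \<le> n" for m n
      using that by (fastforce simp: E_def)
    then have dec: "decseq E" by (simp add: decseq_def)
    have int: "(\<Inter>n. E n) = {}"
    proof -
      have "\<exists>n. r \<notin> E n" for r
      proof (cases "r = s")
        case False
        then obtain n where "h n < \<bar>r - s\<bar>"
          using nat_approx_posE[of "\<bar>r - s\<bar>"] by (auto simp: h_def)
        then show ?thesis by (intro exI[of _ n]) (auto simp: E_def abs_if split: if_splits)
      qed (auto simp: E_def)
      then show ?thesis by auto
    qed
    obtain n where n: "tvar \<phi> (E n) < e"
      using tvar_decseq[OF om _ _ dec int \<open>0 < e\<close>] J by (auto simp: E_def)
    define d where "d = h n"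
    have "0 < d" by (simp add: d_def h_def)
    let ?S = "J \<inter> {s - d<..s + d}"
    have "tvar \<phi> ?S = tvar \<phi> (E n)"
    proof (cases "s \<in> J")
      case True
      have "?S = {s} \<union> E n" using True \<open>0 < d\<close> by (auto simp: E_def d_def)
      moreover have "tvar \<phi> ({s} \<union> E n) = tvar \<phi> {s} + tvar \<phi> (E n)"
        using True J by (intro tvar_Un[OF om]) (auto simp: E_def)
      ultimately show ?thesis using tvar_singleton[OF om True] by simp
    next
      case False
      then have "?S = E n" by (auto simp: E_def d_def)
      then show ?thesis by simp
    qed
    with n have S: "tvar \<phi> ?S < e" by simp
    have le: "tvar \<phi> (J \<inter> {..v}) - tvar \<phi> (J \<inter> {..u}) \<le> tvar \<phi> ?S \<and> tvar \<phi> (J \<inter> {..u}) \<le> tvar \<phi> (J \<inter> {..v})"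
      if "u \<le> v" "s - d < u" "v \<le> s + d" for u v
    proof
      have "tvar \<phi> (J \<inter> {..v} - J \<inter> {..u}) = tvar \<phi> (J \<inter> {..v}) - tvar \<phi> (J \<inter> {..u})"
        using that J by (intro tvar_Diff[OF om]) auto
      moreover have "tvar \<phi> (J \<inter> {..v} - J \<inter> {..u}) \<le> tvar \<phi> ?S"
        using that J by (intro tvar_mono[OF om]) auto
      ultimately show "tvar \<phi> (J \<inter> {..v}) - tvar \<phi> (J \<inter> {..u}) \<le> tvar \<phi> ?S" by simp
      show "tvar \<phi> (J \<inter> {..u}) \<le> tvar \<phi> (J \<inter> {..v})"
        using that J by (intro tvar_mono[OF om]) auto
    qed
    have "\<bar>tvar \<phi> (J \<inter> {..r}) - tvar \<phi> (J \<inter> {..s})\<bar> < e" if "\<bar>r - s\<bar> < d" for r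
      using le[of r s] le[of s r] that S by (cases "r \<le> s") auto
    with \<open>0 < d\<close> show ?thesis by blast
  qed
  then show ?thesis
    unfolding continuous_at_eps_delta dist_real_def by blast
qed

text \<open>Far to the left the cuts have variation below w, far to the right above w, and the
  intermediate value theorem applies. If J is unbounded, 0 and the full variation need not be
  attained by a cut at a real number; the segments {} and J serve instead.\<close>

lemma initial_segment_tvar_exists:
  assumes om: "ordered_measure J \<phi>" and w: "0 \<le> w" "w \<le> tvar \<phi> J"
  shows "\<exists>D. initial_segment D J \<and> tvar \<phi> D = w"
proof -
  note J = ordered_measure_borel[OF om]
  let ?v = "\<lambda>s. tvar \<phi> (J \<inter> {..s})"
  consider "w = 0" | "w = tvar \<phi> J" | "0 < w" "w < tvar \<phi> J" using w by linarith
  then show ?thesis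
  proof cases
    case 1
    then show ?thesis using om by (intro exI[of _ "{}"]) (auto simp: initial_segment_def)
  next
    case 2
    then show ?thesis by (intro exI[of _ J]) (auto simp: initial_segment_def)
  next
    case 3
    have "\<exists>n. tvar \<phi> (J \<inter> {..- real n}) < w"
    proof (rule tvar_decseq[OF om _ _ _ _ 3(1)])
      have "\<exists>n. x \<notin> {..- real n}" for x
        using reals_Archimedean2[of "- x"] by (auto simp: minus_less_iff not_le)
      then show "(\<Inter>n. J \<inter> {..- real n}) = {}" by blast
    qed (use J in \<open>auto simp: decseq_def\<close>)
    then obtain m where m: "?v (- real m) < w" by blast
    have "\<exists>n. tvar \<phi> (J \<inter> {real n<..}) < tvar \<phi> J - w"
    proof (rule tvar_decseq[OF om])
      have "\<exists>n. x \<notin> {real n<..}" for x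
        using reals_Archimedean2[of x] by (auto simp: not_less intro: less_imp_le)
      then show "(\<Inter>n. J \<inter> {real n<..}) = {}" by blast
    qed (use J 3 in \<open>auto simp: decseq_def\<close>)
    then obtain n where "tvar \<phi> (J \<inter> {real n<..}) < tvar \<phi> J - w" by blast
    moreover have "tvar \<phi> (J - J \<inter> {..real n}) = tvar \<phi> J - ?v (real n)"
      using J by (intro tvar_Diff[OF om]) auto
    moreover have "J - J \<inter> {..real n} = J \<inter> {real n<..}" by auto
    ultimately have n: "w < ?v (real n)" by simp
    have "\<exists>x\<ge>- real m. x \<le> real n \<and> ?v x = w"
      using m n by (intro IVT allI impI isCont_tvar_atMost[OF om]) auto
    then show ?thesis using initial_segment_atMost by blast
  qed
qed

section \<open>Integration of operator-valued functions\<close>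

lemma simple_function_cells:
  assumes "E \<in> sets borel" "simple_function (restrict_space borel E) g"
  shows "finite (g ` E)" "g -` X \<inter> E \<in> sets borel"
  using simple_functionD[OF assms(2)] assms(1)
  by (auto simp: space_restrict_space sets_restrict_space_iff)

text \<open>Allows summation over the level sets of any g that determines s, not only over those of
  s itself. With g the pair of two simple functions, both integrals are written on common
  cells.\<close>

lemma simple_op_integral_cells:
  assumes om: "ordered_measure I \<phi>" and E: "E \<in> sets borel" "E \<subseteq> I"
    and g: "simple_function (restrict_space borel E) g" and s: "\<And>t. t \<in> E \<Longrightarrow> s t = F (g t)"
  shows "simple_op_integral \<phi> E s = (\<Sum>i\<in>g ` E. \<phi> (g -` {i} \<inter> E) o\<^sub>L F i)"
proof -
  note g' = simple_function_cells[OF E(1) g]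
  have cell: "\<phi> (s -` {y} \<inter> E) = (\<Sum>i\<in>{i \<in> g ` E. F i = y}. \<phi> (g -` {i} \<inter> E))" for y
  proof -
    have "s -` {y} \<inter> E = (\<Union>i\<in>{i \<in> g ` E. F i = y}. g -` {i} \<inter> E)" using s by auto
    then show ?thesis
      by (simp only:) (rule ordered_measure_finite_Union[OF om], use g' E in \<open>auto simp: disjoint_family_on_def\<close>)
  qed
  have "s ` E = F ` (g ` E)" using s by force
  then have "simple_op_integral \<phi> E s
      = (\<Sum>y\<in>F ` (g ` E). \<Sum>i\<in>{i \<in> g ` E. F i = y}. \<phi> (g -` {i} \<inter> E) o\<^sub>L y)"
    unfolding simple_op_integral_def cell
    by (simp add: bounded_bilinear.sum_left[OF bounded_bilinear_blinfun_compose])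
  also have "\<dots> = (\<Sum>y\<in>F ` (g ` E). \<Sum>i\<in>{i \<in> g ` E. F i = y}. \<phi> (g -` {i} \<inter> E) o\<^sub>L F i)"
    by (intro sum.cong refl) auto
  also have "\<dots> = (\<Sum>i\<in>g ` E. \<phi> (g -` {i} \<inter> E) o\<^sub>L F i)"
    using g' by (intro sum.image_gen[symmetric])
  finally show ?thesis .
qed

lemma simple_op_integral_diff:
  assumes om: "ordered_measure I \<phi>" and E: "E \<in> sets borel" "E \<subseteq> I"
    and s: "simple_function (restrict_space borel E) s" "simple_function (restrict_space borel E) r"
  shows "simple_op_integral \<phi> E (\<lambda>t. s t - r t) = simple_op_integral \<phi> E s - simple_op_integral \<phi> E r"
proof -
  let ?g = "\<lambda>t. (s t, r t)"
  have g: "simple_function (restrict_space borel E) ?g" using s by (rule simple_function_Pair)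
  show ?thesis
    unfolding simple_op_integral_cells[OF om E g, of s fst, simplified]
      simple_op_integral_cells[OF om E g, of r snd, simplified]
      simple_op_integral_cells[OF om E g, of "\<lambda>t. s t - r t" "\<lambda>p. fst p - snd p", simplified]
    by (simp add: bounded_bilinear.diff_right[OF bounded_bilinear_blinfun_compose] sum_subtractf)
qed

text \<open>Stated at a single vector x because the estimate along an orbit compares norms of
  vectors, where operator norms would be too coarse.\<close>

lemma simple_op_integral_bound:
  fixes \<phi> :: "real set \<Rightarrow> ('h::real_normed_vector \<Rightarrow>\<^sub>L 'h)" and s :: "real \<Rightarrow> 'h \<Rightarrow>\<^sub>L 'h"
  assumes om: "ordered_measure I \<phi>" and E: "E \<in> sets borel" "E \<subseteq> I"
    and s: "simple_function (restrict_space borel E) s"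
    and M: "0 \<le> M" "\<And>t. t \<in> E \<Longrightarrow> norm (s t x) \<le> M"
  shows "norm (simple_op_integral \<phi> E s x) \<le> M * tvar \<phi> E"
proof -
  note s' = simple_function_cells[OF E(1) s]
  have "norm (simple_op_integral \<phi> E s x) = norm (\<Sum>y\<in>s ` E. \<phi> (s -` {y} \<inter> E) (y x))"
    by (simp add: simple_op_integral_def blinfun.sum_left)
  also have "\<dots> \<le> (\<Sum>y\<in>s ` E. M * norm (\<phi> (s -` {y} \<inter> E)))"
  proof (rule sum_norm_le)
    fix y assume "y \<in> s ` E"
    then have "norm (y x) \<le> M" using M by auto
    have "norm (\<phi> (s -` {y} \<inter> E) (y x)) \<le> norm (\<phi> (s -` {y} \<inter> E)) * norm (y x)"
      by (rule norm_blinfun)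
    also have "\<dots> \<le> norm (\<phi> (s -` {y} \<inter> E)) * M"
      using \<open>norm (y x) \<le> M\<close> by (rule mult_left_mono) simp
    finally show "norm (\<phi> (s -` {y} \<inter> E) (y x)) \<le> M * norm (\<phi> (s -` {y} \<inter> E))"
      by (simp add: mult.commute)
  qed
  also have "\<dots> = M * (\<Sum>y\<in>s ` E. norm (\<phi> (s -` {y} \<inter> E)))" by (simp add: sum_distrib_left)
  also have "\<dots> \<le> M * tvar \<phi> E"
  proof (rule mult_left_mono[OF _ M(1)])
    show "(\<Sum>y\<in>s ` E. norm (\<phi> (s -` {y} \<inter> E))) \<le> tvar \<phi> E"
      using s' E by (intro sum_norm_le_tvar[OF om]) (auto simp: disjoint_family_on_def)
  qed
  finally show ?thesis .
qed

lemma simple_op_integral_Un: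
  assumes om: "ordered_measure I \<phi>" and A: "A \<in> sets borel" "A \<subseteq> I" and B: "B \<in> sets borel" "B \<subseteq> I"
    and disj: "A \<inter> B = {}" and s: "simple_function (restrict_space borel (A \<union> B)) s"
  shows "simple_op_integral \<phi> (A \<union> B) s = simple_op_integral \<phi> A s + simple_op_integral \<phi> B s"
proof -
  have AB: "A \<union> B \<in> sets borel" using A B by auto
  note s' = simple_function_cells[OF AB s]
  have m: "s -` {y} \<inter> C \<in> sets borel" if "C \<in> sets borel" "C \<subseteq> A \<union> B" for y C
  proof -
    have "s -` {y} \<inter> C = (s -` {y} \<inter> (A \<union> B)) \<inter> C" using that by auto
    then show ?thesis using s'(2)[of "{y}"] that by (metis sets.Int)
  qed
  have "\<phi> (s -` {y} \<inter> (A \<union> B)) = \<phi> (s -` {y} \<inter> A) + \<phi> (s -` {y} \<inter> B)" for y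
    unfolding Int_Un_distrib using A B disj m by (intro ordered_measure_Un[OF om]) auto
  then have "simple_op_integral \<phi> (A \<union> B) s = (\<Sum>y\<in>s ` (A \<union> B). \<phi> (s -` {y} \<inter> A) o\<^sub>L y)
      + (\<Sum>y\<in>s ` (A \<union> B). \<phi> (s -` {y} \<inter> B) o\<^sub>L y)"
    by (simp add: simple_op_integral_def sum.distrib
        bounded_bilinear.add_left[OF bounded_bilinear_blinfun_compose])
  moreover have "(\<Sum>y\<in>s ` (A \<union> B). \<phi> (s -` {y} \<inter> C) o\<^sub>L y) = simple_op_integral \<phi> C s"
    if "C \<subseteq> A \<union> B" for C
    unfolding simple_op_integral_def
  proof (rule sum.mono_neutral_right)
    show "\<forall>y\<in>s ` (A \<union> B) - s ` C. \<phi> (s -` {y} \<inter> C) o\<^sub>L y = 0"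
    proof
      fix y assume "y \<in> s ` (A \<union> B) - s ` C"
      then have "y \<notin> s ` C" by simp
      then have "s -` {y} \<inter> C = {}" by blast
      then show "\<phi> (s -` {y} \<inter> C) o\<^sub>L y = 0"
        by (simp add: ordered_measure_empty[OF om] bounded_bilinear.zero_left[OF bounded_bilinear_blinfun_compose])
    qed
  qed (use s' that in auto)
  ultimately show ?thesis by simp
qed

text \<open>Replaces the sequence by a single e that controls the uniform distance and the value
  together, so limit arguments become bookkeeping with e. Conversely e = 1 / (n + 1) produces a
  sequence.\<close>

lemma has_op_integral_iff:
  "has_op_integral \<phi> E f v \<longleftrightarrow>
    (\<forall>e>0. \<exists>s. simple_function (restrict_space borel E) s \<and> (\<forall>t\<in>E. norm (s t - f t) < e) \<and>
      norm (simple_op_integral \<phi> E s - v) < e)" (is "?L \<longleftrightarrow> ?R")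
proof
  assume ?L
  then obtain s where s: "\<And>n. simple_function (restrict_space borel E) (s n)"
    "uniform_limit E s f sequentially" "(\<lambda>n. simple_op_integral \<phi> E (s n)) \<longlonglongrightarrow> v"
    unfolding has_op_integral_def by blast
  show ?R
  proof (intro allI impI)
    fix e :: real assume "0 < e"
    have "\<forall>\<^sub>F n in sequentially. \<forall>t\<in>E. dist (s n t) (f t) < e"
      using s(2) \<open>0 < e\<close> by (rule uniform_limitD)
    moreover have "\<forall>\<^sub>F n in sequentially. dist (simple_op_integral \<phi> E (s n)) v < e"
      using s(3) \<open>0 < e\<close> by (rule tendstoD)
    ultimately have "\<forall>\<^sub>F n in sequentially. (\<forall>t\<in>E. dist (s n t) (f t) < e) \<and> dist (simple_op_integral \<phi> E (s n)) v < e"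
      by (rule eventually_conj)
    then obtain n where "(\<forall>t\<in>E. dist (s n t) (f t) < e) \<and> dist (simple_op_integral \<phi> E (s n)) v < e"
      unfolding eventually_sequentially by blast
    then show "\<exists>s. simple_function (restrict_space borel E) s \<and> (\<forall>t\<in>E. norm (s t - f t) < e) \<and>
      norm (simple_op_integral \<phi> E s - v) < e"
      using s(1)[of n] unfolding dist_norm by blast
  qed
next
  assume R: ?R
  have "\<exists>s. simple_function (restrict_space borel E) s \<and> (\<forall>t\<in>E. norm (s t - f t) < 1 / real (Suc n)) \<and>
      norm (simple_op_integral \<phi> E s - v) < 1 / real (Suc n)" for n
    by (rule R[rule_format]) simp
  then obtain s where s: "\<And>n. simple_function (restrict_space borel E) (s n)"
    "\<And>n t. t \<in> E \<Longrightarrow> norm (s n t - f t) < 1 / real (Suc n)"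
    "\<And>n. norm (simple_op_integral \<phi> E (s n) - v) < 1 / real (Suc n)" by metis
  have small: "\<exists>N. \<forall>n\<ge>N. 1 / real (Suc n) < e" if "0 < e" for e
    using lim_1_over_n[THEN LIMSEQ_Suc, THEN order_tendstoD(2), of e] that
    by (simp add: eventually_sequentially)
  have "uniform_limit E s f sequentially"
  proof (rule uniform_limitI)
    fix e :: real assume "0 < e"
    then obtain N where "\<forall>n\<ge>N. 1 / real (Suc n) < e" using small by blast
    then have "\<forall>t\<in>E. dist (s n t) (f t) < e" if "n \<ge> N" for n
      using that s(2)[of _ n] unfolding dist_norm by (meson order_less_trans)
    then show "\<forall>\<^sub>F n in sequentially. \<forall>t\<in>E. dist (s n t) (f t) < e"
      unfolding eventually_sequentially by blast
  qed
  moreover have "(\<lambda>n. simple_op_integral \<phi> E (s n)) \<longlonglongrightarrow> v"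
  proof (rule LIMSEQ_I)
    fix e :: real assume "0 < e"
    then obtain N where "\<forall>n\<ge>N. 1 / real (Suc n) < e" using small by blast
    then show "\<exists>N. \<forall>n\<ge>N. norm (simple_op_integral \<phi> E (s n) - v) < e"
      using s(3) by (meson order_less_trans)
  qed
  ultimately show ?L unfolding has_op_integral_def using s(1) by blast
qed

lemma has_op_integral_cong:
  assumes "\<And>t. t \<in> E \<Longrightarrow> f t = g t"
  shows "has_op_integral \<phi> E f v \<longleftrightarrow> has_op_integral \<phi> E g v"
  using assms by (simp add: has_op_integral_iff)

text \<open>Uniform limits with a prescribed value v; this carries the integral equation from the
  partial sums of the exponential to the exponential.\<close>

lemma has_op_integral_closure:
  assumes "\<And>e. 0 < e \<Longrightarrow> \<exists>g w. has_op_integral \<phi> E g w \<and> (\<forall>t\<in>E. norm (g t - f t) < e) \<and> norm (w - v) < e"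
  shows "has_op_integral \<phi> E f v"
  unfolding has_op_integral_iff
proof (intro allI impI)
  fix e :: real assume "0 < e"
  then obtain g w where g: "has_op_integral \<phi> E g w" "\<And>t. t \<in> E \<Longrightarrow> norm (g t - f t) < e / 2" "norm (w - v) < e / 2"
    using assms[of "e / 2"] by auto
  obtain s where s: "simple_function (restrict_space borel E) s" "\<And>t. t \<in> E \<Longrightarrow> norm (s t - g t) < e / 2"
    "norm (simple_op_integral \<phi> E s - w) < e / 2"
    using g(1) \<open>0 < e\<close> unfolding has_op_integral_iff by (meson half_gt_zero)
  have "norm (s t - f t) < e" if "t \<in> E" for t
    using norm_diff_triangle_less[OF s(2)[OF that] g(2)[OF that]] by simp
  moreover have "norm (simple_op_integral \<phi> E s - v) < e"
    using norm_diff_triangle_less[OF s(3) g(3)] by simp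
  ultimately show "\<exists>s. simple_function (restrict_space borel E) s \<and> (\<forall>t\<in>E. norm (s t - f t) < e) \<and>
      norm (simple_op_integral \<phi> E s - v) < e"
    using s(1) by blast
qed

lemma norm_triangle_diff4:
  fixes a b c d :: "'a::real_normed_vector"
  shows "norm ((a - b) - (c - d)) \<le> norm (a - c) + norm (b - d)"
proof -
  have "(a - b) - (c - d) = (a - c) - (b - d)" by simp
  then show ?thesis by (metis norm_triangle_ineq4)
qed

lemma has_op_integral_diff:
  assumes om: "ordered_measure I \<phi>" and E: "E \<in> sets borel" "E \<subseteq> I"
    and f: "has_op_integral \<phi> E f v" and g: "has_op_integral \<phi> E g w"
  shows "has_op_integral \<phi> E (\<lambda>t. f t - g t) (v - w)"
  unfolding has_op_integral_iff
proof (intro allI impI)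
  fix e :: real assume "0 < e"
  obtain s where s: "simple_function (restrict_space borel E) s" "\<And>t. t \<in> E \<Longrightarrow> norm (s t - f t) < e / 2"
    "norm (simple_op_integral \<phi> E s - v) < e / 2"
    using f \<open>0 < e\<close> unfolding has_op_integral_iff by (meson half_gt_zero)
  obtain r where r: "simple_function (restrict_space borel E) r" "\<And>t. t \<in> E \<Longrightarrow> norm (r t - g t) < e / 2"
    "norm (simple_op_integral \<phi> E r - w) < e / 2"
    using g \<open>0 < e\<close> unfolding has_op_integral_iff by (meson half_gt_zero)
  show "\<exists>s. simple_function (restrict_space borel E) s \<and> (\<forall>t\<in>E. norm (s t - (f t - g t)) < e) \<and>
      norm (simple_op_integral \<phi> E s - (v - w)) < e"
  proof (intro exI conjI ballI)
    show "simple_function (restrict_space borel E) (\<lambda>t. s t - r t)"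
      using s(1) r(1) by (rule simple_function_compose2)
    show "norm (s t - r t - (f t - g t)) < e" if "t \<in> E" for t
      using norm_triangle_diff4[of "s t" "r t" "f t" "g t"] s(2)[OF that] r(2)[OF that] by linarith
    show "norm (simple_op_integral \<phi> E (\<lambda>t. s t - r t) - (v - w)) < e"
      unfolding simple_op_integral_diff[OF om E s(1) r(1)]
      using norm_triangle_diff4[of "simple_op_integral \<phi> E s" "simple_op_integral \<phi> E r" v w] s(3) r(3)
      by linarith
  qed
qed

lemma has_op_integral_zero:
  fixes \<phi> :: "real set \<Rightarrow> ('h::real_normed_vector \<Rightarrow>\<^sub>L 'h)"
  assumes "ordered_measure I \<phi>"
  shows "has_op_integral \<phi> E (\<lambda>t. 0) 0"
  unfolding has_op_integral_iff
proof (intro allI impI exI conjI)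
  show "simple_function (restrict_space borel E) (\<lambda>t. 0 :: 'h \<Rightarrow>\<^sub>L 'h)" by simp
  have "simple_op_integral \<phi> E (\<lambda>t. 0) = 0"
    unfolding simple_op_integral_def
    by (intro sum.neutral) (auto simp: bounded_bilinear.zero_right[OF bounded_bilinear_blinfun_compose])
  then show "norm (simple_op_integral \<phi> E (\<lambda>t. 0) - 0) < e" if "0 < e" for e
    using that by simp
qed simp

lemma has_op_integral_add:
  assumes om: "ordered_measure I \<phi>" and E: "E \<in> sets borel" "E \<subseteq> I"
    and f: "has_op_integral \<phi> E f v" and g: "has_op_integral \<phi> E g w"
  shows "has_op_integral \<phi> E (\<lambda>t. f t + g t) (v + w)"
  using has_op_integral_diff[OF om E f has_op_integral_diff[OF om E has_op_integral_zero[OF om] g]]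
  by simp

lemma has_op_integral_sum:
  assumes om: "ordered_measure I \<phi>" and E: "E \<in> sets borel" "E \<subseteq> I"
    and f: "\<And>k. k < (n::nat) \<Longrightarrow> has_op_integral \<phi> E (f k) (v k)"
  shows "has_op_integral \<phi> E (\<lambda>t. \<Sum>k<n. f k t) (\<Sum>k<n. v k)"
  using f
proof (induction n)
  case 0
  then show ?case using has_op_integral_zero[OF om] by simp
next
  case (Suc n)
  then show ?case using has_op_integral_add[OF om E, of "\<lambda>t. \<Sum>k<n. f k t"] by simp
qed

lemma has_op_integral_bound:
  fixes \<phi> :: "real set \<Rightarrow> ('h::real_normed_vector \<Rightarrow>\<^sub>L 'h)" and f :: "real \<Rightarrow> 'h \<Rightarrow>\<^sub>L 'h"
  assumes om: "ordered_measure I \<phi>" and E: "E \<in> sets borel" "E \<subseteq> I"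
    and f: "has_op_integral \<phi> E f v" and M: "0 \<le> M" "\<And>t. t \<in> E \<Longrightarrow> norm (f t x) \<le> M"
  shows "norm (v x) \<le> M * tvar \<phi> E"
proof (rule field_le_epsilon)
  fix e :: real assume "0 < e"
  \<comment> \<open>The integrand contributes an error of d \<open>norm x\<close> per unit of
    variation and the value another d \<open>norm x\<close>; the final 1 keeps the denominator
    positive.\<close>
  define d where "d = e / (norm x * (tvar \<phi> E + 1) + 1)"
  have pos: "0 < norm x * (tvar \<phi> E + 1) + 1" by (intro add_nonneg_pos mult_nonneg_nonneg) auto
  then have "0 < d" using \<open>0 < e\<close> by (simp add: d_def)
  then obtain s where s: "simple_function (restrict_space borel E) s" "\<And>t. t \<in> E \<Longrightarrow> norm (s t - f t) < d"
    "norm (simple_op_integral \<phi> E s - v) < d"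
    using f unfolding has_op_integral_iff by meson
  have nb: "norm (A x) \<le> norm (B x) + d * norm x" if "norm (A - B) < d" for A B :: "'h \<Rightarrow>\<^sub>L 'h"
  proof -
    have "norm (A x - B x) \<le> norm (A - B) * norm x" using norm_blinfun[of "A - B" x] by (simp add: blinfun.diff_left)
    also have "\<dots> \<le> d * norm x" using that by (intro mult_right_mono) auto
    finally show ?thesis using norm_triangle_ineq2[of "A x" "B x"] by linarith
  qed
  have "norm (simple_op_integral \<phi> E s x) \<le> (M + d * norm x) * tvar \<phi> E"
  proof (rule simple_op_integral_bound[OF om E s(1)])
    show "0 \<le> M + d * norm x" using M \<open>0 < d\<close> by simp
    show "norm (s t x) \<le> M + d * norm x" if "t \<in> E" for t
      using nb[OF s(2)[OF that]] M(2)[OF that] by linarith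
  qed
  moreover have "norm (v x) \<le> norm (simple_op_integral \<phi> E s x) + d * norm x"
    using s(3) by (intro nb) (simp add: norm_minus_commute)
  ultimately have "norm (v x) \<le> M * tvar \<phi> E + d * (norm x * (tvar \<phi> E + 1))"
    by (simp add: algebra_simps)
  also have "d * (norm x * (tvar \<phi> E + 1)) \<le> d * (norm x * (tvar \<phi> E + 1) + 1)"
    using \<open>0 < d\<close> by (intro mult_left_mono) auto
  also have "\<dots> = e" using pos by (simp add: d_def)
  finally show "norm (v x) \<le> M * tvar \<phi> E + e" by simp
qed

lemma has_op_integral_norm_bound:
  assumes om: "ordered_measure I \<phi>" and E: "E \<in> sets borel" "E \<subseteq> I"
    and f: "has_op_integral \<phi> E f v" and M: "0 \<le> M" "\<And>t. t \<in> E \<Longrightarrow> norm (f t) \<le> M"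
  shows "norm v \<le> M * tvar \<phi> E"
proof (rule norm_blinfun_bound)
  fix x
  have "norm (v x) \<le> (M * norm x) * tvar \<phi> E"
  proof (rule has_op_integral_bound[OF om E f])
    show "norm (f t x) \<le> M * norm x" if "t \<in> E" for t
      using norm_blinfun[of "f t" x] mult_right_mono[OF M(2)[OF that], of "norm x"] by simp
  qed (use M in simp)
  then show "norm (v x) \<le> M * tvar \<phi> E * norm x" by (simp add: mult_ac)
qed (use M in simp)

lemma has_op_integral_unique:
  assumes om: "ordered_measure I \<phi>" and E: "E \<in> sets borel" "E \<subseteq> I"
    and "has_op_integral \<phi> E f v" "has_op_integral \<phi> E f w"
  shows "v = w"
proof -
  have "norm (v - w) \<le> 0 * tvar \<phi> E"
    using has_op_integral_diff[OF om E assms(4,5)]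
    by (rule has_op_integral_norm_bound[OF om E]) auto
  then show ?thesis by simp
qed

lemma op_integral_eq:
  assumes om: "ordered_measure I \<phi>" and E: "E \<in> sets borel" "E \<subseteq> I"
    and f: "has_op_integral \<phi> E f v"
  shows "op_integral \<phi> E f = v"
  unfolding op_integral_def using f has_op_integral_unique[OF om E] by blast

lemma has_op_integral_Un:
  assumes om: "ordered_measure I \<phi>" and A: "A \<in> sets borel" "A \<subseteq> I" and B: "B \<in> sets borel" "B \<subseteq> I"
    and disj: "A \<inter> B = {}" and f: "has_op_integral \<phi> A f v" "has_op_integral \<phi> B f w"
  shows "has_op_integral \<phi> (A \<union> B) f (v + w)"
  unfolding has_op_integral_iff
proof (intro allI impI)
  fix e :: real assume "0 < e"
  obtain s where s: "simple_function (restrict_space borel A) s" "\<And>t. t \<in> A \<Longrightarrow> norm (s t - f t) < e / 2"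
    "norm (simple_op_integral \<phi> A s - v) < e / 2"
    using f(1) \<open>0 < e\<close> unfolding has_op_integral_iff by (meson half_gt_zero)
  obtain r where r: "simple_function (restrict_space borel B) r" "\<And>t. t \<in> B \<Longrightarrow> norm (r t - f t) < e / 2"
    "norm (simple_op_integral \<phi> B r - w) < e / 2"
    using f(2) \<open>0 < e\<close> unfolding has_op_integral_iff by (meson half_gt_zero)
  define h where "h t = (if t \<in> A then s t else r t)" for t
  have h: "simple_function (restrict_space borel (A \<union> B)) h"
    unfolding simple_function_def
  proof (intro conjI ballI)
    have "h ` (A \<union> B) \<subseteq> s ` A \<union> r ` B" by (auto simp: h_def)
    then show "finite (h ` space (restrict_space borel (A \<union> B)))"
      using simple_function_cells(1)[OF A(1) s(1)] simple_function_cells(1)[OF B(1) r(1)]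
      by (auto simp: space_restrict_space intro: finite_subset)
    fix y
    have "h -` {y} \<inter> (A \<union> B) = (s -` {y} \<inter> A) \<union> (r -` {y} \<inter> B)"
      using disj by (auto simp: h_def)
    then have "h -` {y} \<inter> (A \<union> B) \<in> sets borel"
      using simple_function_cells(2)[OF A(1) s(1)] simple_function_cells(2)[OF B(1) r(1)] by simp
    then show "h -` {y} \<inter> space (restrict_space borel (A \<union> B)) \<in> sets (restrict_space borel (A \<union> B))"
      using A B by (simp add: space_restrict_space sets_restrict_space_iff)
  qed
  have hA: "simple_op_integral \<phi> A h = simple_op_integral \<phi> A s"
    unfolding simple_op_integral_def by (intro sum.cong arg_cong2[of _ _ _ _ "(o\<^sub>L)"] arg_cong[of _ _ \<phi>]) (auto simp: h_def)
  have hB: "simple_op_integral \<phi> B h = simple_op_integral \<phi> B r"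
  proof -
    have "h ` B = r ` B" "h -` {y} \<inter> B = r -` {y} \<inter> B" for y using disj by (force simp: h_def)+
    then show ?thesis unfolding simple_op_integral_def by simp
  qed
  show "\<exists>s. simple_function (restrict_space borel (A \<union> B)) s \<and> (\<forall>t\<in>A \<union> B. norm (s t - f t) < e) \<and>
      norm (simple_op_integral \<phi> (A \<union> B) s - (v + w)) < e"
  proof (intro exI conjI ballI)
    show "simple_function (restrict_space borel (A \<union> B)) h" by (rule h)
    show "norm (h t - f t) < e" if "t \<in> A \<union> B" for t
      using that s(2)[of t] r(2)[of t] \<open>0 < e\<close> by (auto simp: h_def)
    show "norm (simple_op_integral \<phi> (A \<union> B) h - (v + w)) < e"
      unfolding simple_op_integral_Un[OF om A B disj h] hA hB
      using norm_diff_triangle_ineq[of "simple_op_integral \<phi> A s" "simple_op_integral \<phi> B r" v w] s(3) r(3)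
      by linarith
  qed
qed

text \<open>Finite variation makes the simple integrals Cauchy, and completeness supplies the value.
  The conclusion retains the given sequence so that closed properties of its terms pass to the
  integral.\<close>

lemma has_op_integral_of_approx:
  fixes \<phi> :: "real set \<Rightarrow> ('h::{real_normed_vector,complete_space} \<Rightarrow>\<^sub>L 'h)"
  assumes om: "ordered_measure I \<phi>" and E: "E \<in> sets borel" "E \<subseteq> I"
    and s: "\<And>n. simple_function (restrict_space borel E) (s n)"
    and lim: "\<And>n t. t \<in> E \<Longrightarrow> norm (s n t - f t) < 1 / real (Suc n)"
  shows "\<exists>v. has_op_integral \<phi> E f v \<and> (\<lambda>n. simple_op_integral \<phi> E (s n)) \<longlonglongrightarrow> v"
proof -
  have small: "\<exists>N. \<forall>n\<ge>N. 1 / real (Suc n) < e" if "0 < e" for e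
    using lim_1_over_n[THEN LIMSEQ_Suc, THEN order_tendstoD(2), of e] that
    by (simp add: eventually_sequentially)
  have "Cauchy (\<lambda>n. simple_op_integral \<phi> E (s n))"
  proof (rule metric_CauchyI)
    fix e :: real assume "0 < e"
    \<comment> \<open>Half the tolerance for each of the two approximants; the added 1 avoids
      division by zero and makes the final inequality strict.\<close>
    then have "0 < e / (2 * (tvar \<phi> E + 1))" by (simp add: add_nonneg_pos)
    then obtain N where N: "\<And>n. n \<ge> N \<Longrightarrow> 1 / real (Suc n) < e / (2 * (tvar \<phi> E + 1))"
      using small by blast
    have "dist (simple_op_integral \<phi> E (s m)) (simple_op_integral \<phi> E (s n)) < e"
      if mn: "m \<ge> N" "n \<ge> N" for m n
    proof -
      have half: "e / (2 * c) + e / (2 * c) = e / c" for c :: real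
        by (cases "c = 0") (simp_all add: field_simps)
      have st: "norm (s m t - s n t) \<le> e / (tvar \<phi> E + 1)" if "t \<in> E" for t
      proof -
        have "norm (s m t - s n t) \<le> norm (s m t - f t) + norm (s n t - f t)"
          using norm_triangle_ineq4[of "s m t - f t" "s n t - f t"] by simp
        also have "\<dots> \<le> e / (2 * (tvar \<phi> E + 1)) + e / (2 * (tvar \<phi> E + 1))"
          using lim[OF that, of m] lim[OF that, of n] N[OF mn(1)] N[OF mn(2)] by linarith
        also have "\<dots> = e / (tvar \<phi> E + 1)" by (rule half)
        finally show ?thesis .
      qed
      have "norm (simple_op_integral \<phi> E (\<lambda>t. s m t - s n t)) \<le> e / (tvar \<phi> E + 1) * tvar \<phi> E"
      proof (rule norm_blinfun_bound)
        fix x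
        have "norm (simple_op_integral \<phi> E (\<lambda>t. s m t - s n t) x) \<le> (e / (tvar \<phi> E + 1) * norm x) * tvar \<phi> E"
        proof (rule simple_op_integral_bound[OF om E])
          show "simple_function (restrict_space borel E) (\<lambda>t. s m t - s n t)"
            by (rule simple_function_compose2[OF s s])
          show "norm ((s m t - s n t) x) \<le> e / (tvar \<phi> E + 1) * norm x" if "t \<in> E" for t
            by (rule order_trans[OF norm_blinfun mult_right_mono[OF st[OF that]]]) simp
        qed (use \<open>0 < e\<close> in \<open>simp add: add_nonneg_nonneg\<close>)
        then show "norm (simple_op_integral \<phi> E (\<lambda>t. s m t - s n t) x) \<le> e / (tvar \<phi> E + 1) * tvar \<phi> E * norm x"
          by (simp add: mult_ac)
      qed (use \<open>0 < e\<close> in \<open>simp add: add_nonneg_nonneg\<close>)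
      also have "\<dots> < e"
      proof -
        have "0 < tvar \<phi> E + 1" by (simp add: add_nonneg_pos)
        then show ?thesis using \<open>0 < e\<close> by (simp add: field_simps)
      qed
      finally show ?thesis unfolding dist_norm simple_op_integral_diff[OF om E s s] .
    qed
    then show "\<exists>N. \<forall>m\<ge>N. \<forall>n\<ge>N. dist (simple_op_integral \<phi> E (s m)) (simple_op_integral \<phi> E (s n)) < e"
      by blast
  qed
  then obtain v where v: "(\<lambda>n. simple_op_integral \<phi> E (s n)) \<longlonglongrightarrow> v"
    using Cauchy_convergent convergentD by blast
  have "uniform_limit E s f sequentially"
  proof (rule uniform_limitI)
    fix e :: real assume "0 < e"
    then obtain N where "\<forall>n\<ge>N. 1 / real (Suc n) < e" using small by blast
    then have "\<forall>t\<in>E. dist (s n t) (f t) < e" if "n \<ge> N" for n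
      using that lim[of _ n] unfolding dist_norm by (meson order_less_trans)
    then show "\<forall>\<^sub>F n in sequentially. \<forall>t\<in>E. dist (s n t) (f t) < e"
      unfolding eventually_sequentially by blast
  qed
  then show ?thesis using s v unfolding has_op_integral_def by blast
qed

section \<open>Integrability of functions that are Lipschitz in the variation\<close>

definition tvar_lipschitz :: "(real set \<Rightarrow> 'b::real_normed_vector) \<Rightarrow> real set \<Rightarrow> (real \<Rightarrow> 'b) \<Rightarrow> bool" where
  "tvar_lipschitz \<phi> J f \<longleftrightarrow> (\<exists>C\<ge>0. \<forall>s\<in>J. \<forall>t\<in>J. s \<le> t \<longrightarrow>
     norm (f t - f s) \<le> C * (tvar \<phi> (J \<inter> {..t}) - tvar \<phi> (J \<inter> {..s})))"

text \<open>Rounding the monotone function v down to multiples of d sorts E into finitely many Borel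
  cells, on each of which f moves by at most C d. One sample per cell, taken in E, keeps the values
  of the approximant among those of f.\<close>

lemma tvar_lipschitz_approx:
  assumes om: "ordered_measure J \<phi>" and E: "E \<in> sets borel" "E \<subseteq> J"
    and f: "tvar_lipschitz \<phi> J f" and "0 < e"
  shows "\<exists>s. simple_function (restrict_space borel E) s \<and> s ` E \<subseteq> f ` E \<and> (\<forall>t\<in>E. norm (s t - f t) < e)"
proof -
  obtain C where C: "0 \<le> C" "\<And>s t. s \<in> J \<Longrightarrow> t \<in> J \<Longrightarrow> s \<le> t \<Longrightarrow>
     norm (f t - f s) \<le> C * (tvar \<phi> (J \<inter> {..t}) - tvar \<phi> (J \<inter> {..s}))"
    using f unfolding tvar_lipschitz_def by blast
  note J = ordered_measure_borel[OF om]
  define v where "v t = tvar \<phi> (J \<inter> {..t})" for t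
  have "mono v" unfolding v_def
    using J by (intro monoI tvar_mono[OF om]) auto
  then have v: "v \<in> borel_measurable borel" by (rule borel_measurable_mono)
  have v_le: "0 \<le> v t" "v t \<le> tvar \<phi> J" for t
    unfolding v_def using J by (auto intro!: tvar_mono[OF om])
  define d where "d = e / (C + 1)"
  have "0 < d" "C * d < e" using \<open>0 < e\<close> C(1) by (auto simp: d_def field_simps)
  define g where "g t = \<lfloor>v t / d\<rfloor>" for t
  have g: "simple_function (restrict_space borel E) g"
    unfolding simple_function_def
  proof (intro conjI ballI)
    have "g ` E \<subseteq> {0..\<lfloor>tvar \<phi> J / d\<rfloor>}"
      using v_le \<open>0 < d\<close> by (auto simp: g_def intro!: floor_mono divide_right_mono)
    then show "finite (g ` space (restrict_space borel E))"
      by (auto simp: space_restrict_space intro: finite_subset)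
    fix i
    have "g \<in> measurable borel (count_space UNIV)" unfolding g_def using v by measurable
    then have "g -` {i} \<in> sets borel" by (simp add: measurable_def)
    then show "g -` {i} \<inter> space (restrict_space borel E) \<in> sets (restrict_space borel E)"
      using E by (auto simp: space_restrict_space sets_restrict_space_iff)
  qed
  define c where "c i = (SOME t. t \<in> E \<and> g t = i)" for i
  have c: "c (g t) \<in> E" "g (c (g t)) = g t" if "t \<in> E" for t
    using someI[of "\<lambda>u. u \<in> E \<and> g u = g t", OF conjI[OF that refl]] by (auto simp: c_def)
  have dist: "\<bar>v (c (g t)) - v t\<bar> < d" if "t \<in> E" for t
  proof -
    have "\<lfloor>v (c (g t)) / d\<rfloor> = \<lfloor>v t / d\<rfloor>" using c(2)[OF that] by (simp add: g_def)
    then have "\<bar>v (c (g t)) / d - v t / d\<bar> < 1" by linarith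
    then have "\<bar>v (c (g t)) - v t\<bar> / d < 1"
      using \<open>0 < d\<close> by (simp add: abs_divide flip: diff_divide_distrib)
    then show ?thesis using \<open>0 < d\<close> by simp
  qed
  have "norm (f (c (g t)) - f t) < e" if t: "t \<in> E" for t
  proof -
    have in_J: "t \<in> J" "c (g t) \<in> J" using t c(1)[OF t] E by auto
    have "norm (f (c (g t)) - f t) \<le> C * \<bar>v (c (g t)) - v t\<bar>"
    proof (cases "c (g t) \<le> t")
      case True
      then have "norm (f t - f (c (g t))) \<le> C * (v t - v (c (g t)))" using C(2) in_J unfolding v_def by blast
      also have "\<dots> \<le> C * \<bar>v (c (g t)) - v t\<bar>" using C(1) by (intro mult_left_mono) auto
      finally show ?thesis by (simp add: norm_minus_commute)
    next
      case False
      then have "norm (f (c (g t)) - f t) \<le> C * (v (c (g t)) - v t)" using C(2) in_J unfolding v_def by simp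
      also have "\<dots> \<le> C * \<bar>v (c (g t)) - v t\<bar>" using C(1) by (intro mult_left_mono) auto
      finally show ?thesis .
    qed
    also have "\<dots> \<le> C * d" using dist[OF t] C(1) by (intro mult_left_mono) auto
    finally show ?thesis using \<open>C * d < e\<close> by linarith
  qed
  moreover have "simple_function (restrict_space borel E) (\<lambda>t. f (c (g t)))"
    using g by (rule simple_function_compose1)
  moreover have "(\<lambda>t. f (c (g t))) ` E \<subseteq> f ` E" using c(1) by auto
  ultimately show ?thesis by blast
qed

lemma tvar_lipschitz_approx_seq:
  assumes om: "ordered_measure J \<phi>" and E: "E \<in> sets borel" "E \<subseteq> J" and f: "tvar_lipschitz \<phi> J f"
  shows "\<exists>s. \<forall>n. simple_function (restrict_space borel E) (s n) \<and> s n ` E \<subseteq> f ` E \<and>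
    (\<forall>t\<in>E. norm (s n t - f t) < 1 / real (Suc n))"
  by (intro choice allI tvar_lipschitz_approx[OF om E f]) simp

lemma tvar_lipschitz_integrable:
  fixes \<phi> :: "real set \<Rightarrow> ('h::{real_normed_vector,complete_space} \<Rightarrow>\<^sub>L 'h)"
  assumes om: "ordered_measure J \<phi>" and E: "E \<in> sets borel" "E \<subseteq> J" and f: "tvar_lipschitz \<phi> J f"
  shows "\<exists>v. has_op_integral \<phi> E f v"
proof -
  obtain s where "\<forall>n. simple_function (restrict_space borel E) (s n) \<and> s n ` E \<subseteq> f ` E \<and>
    (\<forall>t\<in>E. norm (s n t - f t) < 1 / real (Suc n))"
    using tvar_lipschitz_approx_seq[OF om E f] by blast
  then show ?thesis using has_op_integral_of_approx[OF om E, of s f] by blast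
qed

section \<open>Time-ordered exponentials\<close>

lemma initial_segmentD:
  assumes om: "ordered_measure J \<phi>" and D: "initial_segment D J"
  shows "D \<subseteq> J" "D \<in> sets borel" "J - D \<in> sets borel" "tvar \<phi> (J - D) = tvar \<phi> J - tvar \<phi> D"
    "tvar \<phi> D \<le> tvar \<phi> J" "\<And>s. s \<in> D \<Longrightarrow> D \<inter> {..s} = J \<inter> {..s}"
    "\<And>s. s \<in> J - D \<Longrightarrow> initial_segment D (J \<inter> {..s})"
proof -
  show sub: "D \<subseteq> J" using D by (simp add: initial_segment_def)
  note J = ordered_measure_borel[OF om]
  show b: "D \<in> sets borel" by (rule ordered_measure_borel[OF initial_segment_ordered_measure[OF om D]])
  show "J - D \<in> sets borel" using J b by simp
  show "tvar \<phi> (J - D) = tvar \<phi> J - tvar \<phi> D" using J b sub by (intro tvar_Diff[OF om]) auto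
  show "tvar \<phi> D \<le> tvar \<phi> J" using J b sub by (intro tvar_mono[OF om]) auto
  show "D \<inter> {..s} = J \<inter> {..s}" if "s \<in> D" for s using D that by (auto simp: initial_segment_def)
  show "initial_segment D (J \<inter> {..s})" if "s \<in> J - D" for s
  proof -
    have "y \<le> s" if "y \<in> D" for y
      using D that \<open>s \<in> J - D\<close> unfolding initial_segment_def by (metis DiffD1 DiffD2 linear)
    then show ?thesis using D by (auto simp: initial_segment_def)
  qed
qed

lemma initial_segment_atMost_mono: "s \<le> t \<Longrightarrow> initial_segment (J \<inter> {..s}) (J \<inter> {..t})"
  by (auto simp: initial_segment_def)

text \<open>The Lipschitz hypothesis provides the integrals hidden in definite descriptions. For s
  in D the cuts of J and D at s coincide, so both use the same integrand on D, and additivity over D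
  and \<open>J - D\<close> isolates the increment.\<close>

lemma time_ordered_integral_Suc:
  fixes \<phi> :: "real set \<Rightarrow> ('h::{real_normed_vector,complete_space} \<Rightarrow>\<^sub>L 'h)"
  assumes om: "ordered_measure J \<phi>" and D: "initial_segment D J"
    and lip: "tvar_lipschitz \<phi> J (\<lambda>s. time_ordered_integral \<phi> k (J \<inter> {..s}))"
  shows "has_op_integral \<phi> J (\<lambda>s. time_ordered_integral \<phi> k (J \<inter> {..s})) (time_ordered_integral \<phi> (Suc k) J)"
    and "has_op_integral \<phi> (J - D) (\<lambda>s. time_ordered_integral \<phi> k (J \<inter> {..s}))
      (time_ordered_integral \<phi> (Suc k) J - time_ordered_integral \<phi> (Suc k) D)"
proof -
  let ?f = "\<lambda>s. time_ordered_integral \<phi> k (J \<inter> {..s})"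
  note J = ordered_measure_borel[OF om]
  note d = initial_segmentD[OF om D]
  have omD: "ordered_measure D \<phi>" by (rule initial_segment_ordered_measure[OF om D])
  have int: "\<exists>v. has_op_integral \<phi> E ?f v" if "E \<in> sets borel" "E \<subseteq> J" for E
    using tvar_lipschitz_integrable[OF om that lip] .
  obtain u where u: "has_op_integral \<phi> D ?f u" using int d by blast
  obtain w where w: "has_op_integral \<phi> (J - D) ?f w" using int d by blast
  obtain v where v: "has_op_integral \<phi> J ?f v" using int J by blast
  have Jv: "time_ordered_integral \<phi> (Suc k) J = v"
    using op_integral_eq[OF om J order_refl v] by simp
  then show "has_op_integral \<phi> J ?f (time_ordered_integral \<phi> (Suc k) J)" using v by simp
  have "has_op_integral \<phi> D (\<lambda>s. time_ordered_integral \<phi> k (D \<inter> {..s})) u"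
    using u has_op_integral_cong[of D ?f "\<lambda>s. time_ordered_integral \<phi> k (D \<inter> {..s})"] d(6) by simp
  then have Du: "time_ordered_integral \<phi> (Suc k) D = u"
    using op_integral_eq[OF omD d(2) order_refl] by simp
  have "has_op_integral \<phi> (D \<union> (J - D)) ?f (u + w)"
    using d by (intro has_op_integral_Un[OF om _ _ _ _ _ u w]) auto
  moreover have "D \<union> (J - D) = J" using d(1) by auto
  ultimately have "v = u + w" using has_op_integral_unique[OF om J order_refl v] by simp
  then show "has_op_integral \<phi> (J - D) ?f (time_ordered_integral \<phi> (Suc k) J - time_ordered_integral \<phi> (Suc k) D)"
    using w Jv Du by (simp del: time_ordered_integral.simps)
qed

text \<open>Both bounds are proved in one induction: the next iterated integral exists because the
  increment bound makes the present one Lipschitz. Taking \<open>1 \<le> M\<close> lets the same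
  power of M serve for both.\<close>

lemma time_ordered_integral_bounds:
  fixes \<phi> :: "real set \<Rightarrow> ('h::{real_normed_vector,complete_space} \<Rightarrow>\<^sub>L 'h)"
  assumes M: "1 \<le> M" and "ordered_measure J \<phi>" "tvar \<phi> J \<le> M"
  shows "norm (time_ordered_integral \<phi> k J) \<le> M ^ k \<and> (\<forall>D. initial_segment D J \<longrightarrow>
    norm (time_ordered_integral \<phi> k J - time_ordered_integral \<phi> k D) \<le> M ^ k * (tvar \<phi> J - tvar \<phi> D))"
  using assms(2,3)
proof (induction k arbitrary: J)
  case 0
  then show ?case using initial_segmentD(5)[OF 0(1)] norm_blinfun_id_le by auto
next
  case (Suc k)
  note om = Suc.prems(1)
  note J = ordered_measure_borel[OF om]
  let ?f = "\<lambda>s. time_ordered_integral \<phi> k (J \<inter> {..s})"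
  have sub: "ordered_measure (J \<inter> {..s}) \<phi>" "tvar \<phi> (J \<inter> {..s}) \<le> M" for s
    using initial_segment_ordered_measure[OF om initial_segment_atMost]
      initial_segmentD(5)[OF om initial_segment_atMost[of J s]] Suc.prems(2) by auto
  have bd: "norm (?f s) \<le> M ^ k" for s using Suc.IH[OF sub] by blast
  have "norm (?f t - ?f s) \<le> M ^ k * (tvar \<phi> (J \<inter> {..t}) - tvar \<phi> (J \<inter> {..s}))" if "s \<le> t" for s t
    using Suc.IH[OF sub, of t] initial_segment_atMost_mono[OF that] by blast
  then have lip: "tvar_lipschitz \<phi> J ?f"
    unfolding tvar_lipschitz_def using M by (intro exI[of _ "M ^ k"]) auto
  have "norm (time_ordered_integral \<phi> (Suc k) J) \<le> M ^ k * tvar \<phi> J"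
    using time_ordered_integral_Suc(1)[OF om initial_segment_atMost lip] M bd
    by (intro has_op_integral_norm_bound[OF om J order_refl]) auto
  also have "\<dots> \<le> M ^ Suc k" using M Suc.prems(2) by (simp add: mult.commute mult_right_mono)
  finally have 1: "norm (time_ordered_integral \<phi> (Suc k) J) \<le> M ^ Suc k" .
  have 2: "norm (time_ordered_integral \<phi> (Suc k) J - time_ordered_integral \<phi> (Suc k) D)
      \<le> M ^ Suc k * (tvar \<phi> J - tvar \<phi> D)" if D: "initial_segment D J" for D
  proof -
    note d = initial_segmentD[OF om D]
    have "norm (time_ordered_integral \<phi> (Suc k) J - time_ordered_integral \<phi> (Suc k) D) \<le> M ^ k * tvar \<phi> (J - D)"
      using time_ordered_integral_Suc(2)[OF om D lip] M bd d
      by (intro has_op_integral_norm_bound[OF om d(3)]) auto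
    also have "\<dots> \<le> M ^ Suc k * tvar \<phi> (J - D)"
      using M by (intro mult_right_mono) auto
    finally show ?thesis by (simp only: d(4))
  qed
  show ?case using 1 2 by blast
qed

lemma time_ordered_integral_lipschitz:
  fixes \<phi> :: "real set \<Rightarrow> ('h::{real_normed_vector,complete_space} \<Rightarrow>\<^sub>L 'h)"
  assumes om: "ordered_measure J \<phi>"
  shows "tvar_lipschitz \<phi> J (\<lambda>s. time_ordered_integral \<phi> k (J \<inter> {..s}))"
  unfolding tvar_lipschitz_def
proof (intro exI conjI ballI impI)
  let ?M = "max 1 (tvar \<phi> J)"
  show "0 \<le> ?M ^ k" by simp
  fix s t :: real assume "s \<le> t"
  have "ordered_measure (J \<inter> {..t}) \<phi>" "tvar \<phi> (J \<inter> {..t}) \<le> ?M"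
    using initial_segment_ordered_measure[OF om initial_segment_atMost]
      initial_segmentD(5)[OF om initial_segment_atMost[of J t]] by auto
  then show "norm (time_ordered_integral \<phi> k (J \<inter> {..t}) - time_ordered_integral \<phi> k (J \<inter> {..s}))
      \<le> ?M ^ k * (tvar \<phi> (J \<inter> {..t}) - tvar \<phi> (J \<inter> {..s}))"
    using time_ordered_integral_bounds[of ?M "J \<inter> {..t}" \<phi> k] initial_segment_atMost_mono[OF \<open>s \<le> t\<close>]
    by simp
qed

lemma time_ordered_integral_has_integral:
  fixes \<phi> :: "real set \<Rightarrow> ('h::{real_normed_vector,complete_space} \<Rightarrow>\<^sub>L 'h)"
  assumes om: "ordered_measure J \<phi>"
  shows "has_op_integral \<phi> J (\<lambda>s. time_ordered_integral \<phi> k (J \<inter> {..s})) (time_ordered_integral \<phi> (Suc k) J)"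
  by (rule time_ordered_integral_Suc(1)[OF om initial_segment_atMost time_ordered_integral_lipschitz[OF om]])

lemma time_ordered_integral_diff_has_integral:
  fixes \<phi> :: "real set \<Rightarrow> ('h::{real_normed_vector,complete_space} \<Rightarrow>\<^sub>L 'h)"
  assumes om: "ordered_measure J \<phi>" and D: "initial_segment D J"
  shows "has_op_integral \<phi> (J - D) (\<lambda>s. time_ordered_integral \<phi> k (J \<inter> {..s}))
      (time_ordered_integral \<phi> (Suc k) J - time_ordered_integral \<phi> (Suc k) D)"
  by (rule time_ordered_integral_Suc(2)[OF om D time_ordered_integral_lipschitz[OF om]])

text \<open>
  Cutting an interval into j pieces of variation at most 1/4 gives a bound that is geometric in k;
  no sharper decay is needed.
\<close>

lemma time_ordered_integral_geometric:
  fixes \<phi> :: "real set \<Rightarrow> ('h::{real_normed_vector,complete_space} \<Rightarrow>\<^sub>L 'h)"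
  assumes "ordered_measure J \<phi>" "tvar \<phi> J \<le> real j / 4"
  shows "norm (time_ordered_integral \<phi> k J) \<le> 2 ^ j / 2 ^ k"
  using assms
proof (induction k arbitrary: J j)
  case 0
  have "norm (id_blinfun :: 'h \<Rightarrow>\<^sub>L 'h) \<le> 1" by (rule norm_blinfun_id_le)
  also have "(1::real) \<le> 2 ^ j" by simp
  finally show ?case by simp
next
  case (Suc k)
  note IH = Suc.IH
  from Suc.prems show ?case
  proof (induction j arbitrary: J)
    case 0
    note om = 0(1)
    have "tvar \<phi> J = 0" using 0(2) tvar_nonneg[of \<phi> J] by simp
    moreover have "norm (time_ordered_integral \<phi> k (J \<inter> {..s})) \<le> 2 ^ 0 / 2 ^ k" for s
      using initial_segmentD(5)[OF om initial_segment_atMost[of J s]] 0(2)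
      by (intro IH initial_segment_ordered_measure[OF om initial_segment_atMost]) auto
    then have "norm (time_ordered_integral \<phi> (Suc k) J) \<le> 2 ^ 0 / 2 ^ k * tvar \<phi> J"
      by (intro has_op_integral_norm_bound[OF om ordered_measure_borel[OF om] order_refl
            time_ordered_integral_has_integral[OF om]]) auto
    ultimately show ?case by (simp del: time_ordered_integral.simps)
  next
    case (Suc j)
    note om = Suc.prems(1)
    \<comment> \<open>Cuts off the last piece, of variation at most 1/4. It and D then contribute at
      most 2 ^ j / 2 ^ Suc k each, which add up to the bound for \<open>Suc j\<close>.\<close>
    obtain D where D: "initial_segment D J" "tvar \<phi> D = max 0 (tvar \<phi> J - 1 / 4)"
      using initial_segment_tvar_exists[OF om, of "max 0 (tvar \<phi> J - 1 / 4)"] by auto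
    note d = initial_segmentD[OF om D(1)]
    have "tvar \<phi> D \<le> real j / 4"
      unfolding D(2) using Suc.prems(2) by (auto simp: max_def)
    then have TD: "norm (time_ordered_integral \<phi> (Suc k) D) \<le> 2 ^ j / 2 ^ Suc k"
      by (intro Suc.IH initial_segment_ordered_measure[OF om D(1)])
    have bd: "norm (time_ordered_integral \<phi> k (J \<inter> {..s})) \<le> 2 ^ Suc j / 2 ^ k" for s
      using initial_segmentD(5)[OF om initial_segment_atMost[of J s]] Suc.prems(2)
      by (intro IH initial_segment_ordered_measure[OF om initial_segment_atMost]) auto
    have "norm (time_ordered_integral \<phi> (Suc k) J - time_ordered_integral \<phi> (Suc k) D)
        \<le> 2 ^ Suc j / 2 ^ k * tvar \<phi> (J - D)"
      by (rule has_op_integral_norm_bound[OF om d(3) _ time_ordered_integral_diff_has_integral[OF om D(1)]])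
        (use bd in auto)
    also have "\<dots> \<le> 2 ^ Suc j / 2 ^ k * (1 / 4)"
    proof (rule mult_left_mono)
      show "tvar \<phi> (J - D) \<le> 1 / 4"
        using D(2) d(4) max.cobounded2[of "tvar \<phi> J - 1 / 4" 0] by linarith
    qed simp
    finally have "norm (time_ordered_integral \<phi> (Suc k) J - time_ordered_integral \<phi> (Suc k) D)
        \<le> 2 ^ j / 2 ^ Suc k" by simp
    then have "norm (time_ordered_integral \<phi> (Suc k) J) \<le> 2 ^ j / 2 ^ Suc k + 2 ^ j / 2 ^ Suc k"
      using TD norm_triangle_ineq2[of "time_ordered_integral \<phi> (Suc k) J" "time_ordered_integral \<phi> (Suc k) D"]
      by linarith
    then show ?case by simp
  qed
qed

lemma quarter_count_exists: "\<exists>j::nat. x \<le> real j / 4"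
proof -
  obtain j where "4 * x \<le> real j" using real_arch_simple by blast
  then show ?thesis by (intro exI[of _ j]) simp
qed

lemma summable_time_ordered_integral:
  fixes \<phi> :: "real set \<Rightarrow> ('h::{real_normed_vector,complete_space} \<Rightarrow>\<^sub>L 'h)"
  assumes om: "ordered_measure J \<phi>"
  shows "summable (\<lambda>k. time_ordered_integral \<phi> k J)"
proof -
  obtain j :: nat where j: "tvar \<phi> J \<le> real j / 4" using quarter_count_exists by blast
  show ?thesis
  proof (rule summable_comparison_test')
    show "summable (\<lambda>k. 2 ^ j * (1 / 2) ^ k :: real)" by (intro summable_mult summable_geometric) simp
    show "norm (time_ordered_integral \<phi> k J) \<le> 2 ^ j * (1 / 2) ^ k" if "0 \<le> k" for k
      using time_ordered_integral_geometric[OF om j, of k] by (simp add: power_one_over)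
  qed
qed

lemma exp_L_eq_suminf:
  fixes \<phi> :: "real set \<Rightarrow> ('h::{real_normed_vector,complete_space} \<Rightarrow>\<^sub>L 'h)"
  assumes om: "ordered_measure J \<phi>"
  shows "exp_L J \<phi> = (\<Sum>k. time_ordered_integral \<phi> k J)"
  using suminf_split_head[OF summable_time_ordered_integral[OF om]]
  by (simp add: exp_L_def del: time_ordered_integral.simps(2))

lemma exp_L_tail:
  fixes \<phi> :: "real set \<Rightarrow> ('h::{real_normed_vector,complete_space} \<Rightarrow>\<^sub>L 'h)"
  assumes om: "ordered_measure J \<phi>" and j: "tvar \<phi> J \<le> real j / 4"
  shows "norm (exp_L J \<phi> - (\<Sum>k<n. time_ordered_integral \<phi> k J)) \<le> 2 ^ Suc j / 2 ^ n"
proof -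
  let ?T = "\<lambda>k. time_ordered_integral \<phi> k J"
  have geo: "(\<lambda>k. 2 ^ j / 2 ^ n * (1 / 2) ^ k :: real) sums (2 ^ j / 2 ^ n * (1 / (1 - 1 / 2)))"
    by (intro sums_mult geometric_sums) simp
  have "exp_L J \<phi> - (\<Sum>k<n. ?T k) = (\<Sum>k. ?T (k + n))"
    using suminf_minus_initial_segment[OF summable_time_ordered_integral[OF om], of n]
    by (simp add: exp_L_eq_suminf[OF om])
  also have "norm \<dots> \<le> (\<Sum>k. 2 ^ j / 2 ^ n * (1 / 2) ^ k)"
  proof (rule norm_suminf_le)
    show "norm (?T (k + n)) \<le> 2 ^ j / 2 ^ n * (1 / 2) ^ k" for k
      using time_ordered_integral_geometric[OF om j, of "k + n"] by (simp add: power_add power_one_over field_simps)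
    show "summable (\<lambda>k. 2 ^ j / 2 ^ n * (1 / 2) ^ k :: real)" using geo by (rule sums_summable)
  qed
  also have "\<dots> = 2 ^ j / 2 ^ n * (1 / (1 - 1 / 2))" by (rule sums_unique[OF geo, symmetric])
  also have "\<dots> = 2 ^ Suc j / 2 ^ n" by simp
  finally show ?thesis .
qed

text \<open>The integral equation of the exponential. Partial sums satisfy it with the index shifted
  by one, and the geometric tail bound is uniform over all cuts of J.\<close>

lemma exp_L_diff_has_integral:
  fixes \<phi> :: "real set \<Rightarrow> ('h::{real_normed_vector,complete_space} \<Rightarrow>\<^sub>L 'h)"
  assumes om: "ordered_measure J \<phi>" and D: "initial_segment D J"
  shows "has_op_integral \<phi> (J - D) (\<lambda>s. exp_L (J \<inter> {..s}) \<phi>) (exp_L J \<phi> - exp_L D \<phi>)"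
proof (rule has_op_integral_closure)
  fix e :: real assume "0 < e"
  note d = initial_segmentD[OF om D]
  have omD: "ordered_measure D \<phi>" by (rule initial_segment_ordered_measure[OF om D])
  obtain j :: nat where j: "tvar \<phi> J \<le> real j / 4" using quarter_count_exists by blast
  have "(\<lambda>n. 2 ^ Suc j * (1 / 2) ^ n :: real) \<longlonglongrightarrow> 2 ^ Suc j * 0"
    by (intro tendsto_mult tendsto_const LIMSEQ_power_zero) simp
  then have "\<forall>\<^sub>F n in sequentially. 2 ^ Suc j * (1 / 2) ^ n < e"
    using \<open>0 < e\<close> by (intro order_tendstoD(2)) auto
  then obtain n where "2 ^ Suc j * (1 / 2) ^ n < e"
    by (auto simp: eventually_sequentially)
  then have n: "2 ^ Suc j / 2 ^ n < e" by (simp add: power_one_over)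
  let ?T = "time_ordered_integral \<phi>"
  show "\<exists>g w. has_op_integral \<phi> (J - D) g w \<and> (\<forall>t\<in>J - D. norm (g t - exp_L (J \<inter> {..t}) \<phi>) < e) \<and>
    norm (w - (exp_L J \<phi> - exp_L D \<phi>)) < e"
  proof (intro exI conjI ballI)
    show "has_op_integral \<phi> (J - D) (\<lambda>s. \<Sum>k<n. ?T k (J \<inter> {..s})) (\<Sum>k<n. ?T (Suc k) J - ?T (Suc k) D)"
      using d by (intro has_op_integral_sum[OF om] time_ordered_integral_diff_has_integral[OF om D]) auto
    fix t assume "t \<in> J - D"
    have "tvar \<phi> (J \<inter> {..t}) \<le> real j / 4"
      using initial_segmentD(5)[OF om initial_segment_atMost[of J t]] j by simp
    then have "norm (exp_L (J \<inter> {..t}) \<phi> - (\<Sum>k<n. ?T k (J \<inter> {..t}))) \<le> 2 ^ Suc j / 2 ^ n"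
      by (intro exp_L_tail initial_segment_ordered_measure[OF om initial_segment_atMost])
    then show "norm ((\<Sum>k<n. ?T k (J \<inter> {..t})) - exp_L (J \<inter> {..t}) \<phi>) < e"
      using n by (simp add: norm_minus_commute)
  next
    have tail: "norm (exp_L E \<phi> - (\<Sum>k<Suc n. ?T k E)) \<le> 2 ^ Suc j / 2 ^ Suc n"
      if "ordered_measure E \<phi>" "tvar \<phi> E \<le> tvar \<phi> J" for E
      using that j by (intro exp_L_tail) auto
    \<comment> \<open>The terms k = 0 are both the identity and cancel. The sums on the right have
      one more term, which halves their tails and pays for there being two of them.\<close>
    have eq: "(\<Sum>k<n. ?T (Suc k) J - ?T (Suc k) D) = (\<Sum>k<Suc n. ?T k J) - (\<Sum>k<Suc n. ?T k D)"
      unfolding sum.lessThan_Suc_shift by (simp add: sum_subtractf del: time_ordered_integral.simps(2))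
    have "norm ((\<Sum>k<n. ?T (Suc k) J - ?T (Suc k) D) - (exp_L J \<phi> - exp_L D \<phi>))
        \<le> norm ((\<Sum>k<Suc n. ?T k J) - exp_L J \<phi>) + norm ((\<Sum>k<Suc n. ?T k D) - exp_L D \<phi>)"
      unfolding eq by (rule norm_triangle_diff4)
    also have "\<dots> \<le> 2 ^ Suc j / 2 ^ Suc n + 2 ^ Suc j / 2 ^ Suc n"
      using tail[OF om order_refl] tail[OF omD d(5)] by (intro add_mono) (simp_all only: norm_minus_commute)
    also have "\<dots> = 2 ^ Suc j / 2 ^ n" by simp
    finally show "norm ((\<Sum>k<n. ?T (Suc k) J - ?T (Suc k) D) - (exp_L J \<phi> - exp_L D \<phi>)) < e"
      using n by linarith
  qed
qed

text \<open>Let m be the supremum of the orbit's norm over \<open>J - D\<close>. By the integral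
  equation no displacement from D exceeds m h, so m is at most
  \<open>norm (exp_L D \<phi> x)\<close> + m h, and h < 1 allows solving for m. The resulting h / (1
  - h) differs from exp h - 1 only to second order, which fine partitions do not see.\<close>

lemma exp_L_step:
  fixes \<phi> :: "real set \<Rightarrow> ('h::{real_normed_vector,complete_space} \<Rightarrow>\<^sub>L 'h)"
  assumes om: "ordered_measure J \<phi>" and D: "initial_segment D J" and h: "tvar \<phi> J - tvar \<phi> D \<le> h" "h < 1"
  shows "norm (exp_L J \<phi> x - exp_L D \<phi> x) \<le> h / (1 - h) * norm (exp_L D \<phi> x)"
proof (cases "J - D = {}")
  case True
  then have "J = D" using D by (auto simp: initial_segment_def)
  then show ?thesis using h by (simp add: mult_nonneg_nonneg)
next
  case False
  note d = initial_segmentD[OF om D]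
  have "0 \<le> h" using h d(5) by linarith
  obtain j :: nat where j: "tvar \<phi> J \<le> real j / 4" using quarter_count_exists by blast
  define y where "y s = norm (exp_L (J \<inter> {..s}) \<phi> x)" for s
  \<comment> \<open>A crude bound that makes the supremum m meaningful; the argument with m then
    replaces it by a sharp one.\<close>
  have "y s \<le> 2 ^ Suc j * norm x" for s
  proof -
    have "tvar \<phi> (J \<inter> {..s}) \<le> real j / 4"
      using initial_segmentD(5)[OF om initial_segment_atMost[of J s]] j by simp
    then have "norm (exp_L (J \<inter> {..s}) \<phi>) \<le> 2 ^ Suc j"
      using exp_L_tail[OF initial_segment_ordered_measure[OF om initial_segment_atMost], of s j 0] by simp
    then show ?thesis unfolding y_def
      using norm_blinfun[of "exp_L (J \<inter> {..s}) \<phi>" x] mult_right_mono[of _ _ "norm x"] by fastforce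
  qed
  then have bdd: "bdd_above (y ` (J - D))" by (auto simp: bdd_above_def)
  define m where "m = Sup (y ` (J - D))"
  have y_le: "y s \<le> m" if "s \<in> J - D" for s
    unfolding m_def using that by (intro cSup_upper[OF _ bdd]) auto
  have "0 \<le> m" using False y_le norm_ge_zero unfolding y_def by (meson ex_in_conv order_trans)
  have bound: "norm (exp_L E \<phi> x - exp_L D \<phi> x) \<le> m * h"
    if E: "initial_segment E J" "initial_segment D E" for E
  proof -
    have omE: "ordered_measure E \<phi>" by (rule initial_segment_ordered_measure[OF om E(1)])
    note e = initial_segmentD[OF om E(1)] and de = initial_segmentD[OF omE E(2)]
    have "norm ((exp_L E \<phi> - exp_L D \<phi>) x) \<le> m * tvar \<phi> (E - D)"
    proof (rule has_op_integral_bound[OF omE de(3) _ exp_L_diff_has_integral[OF omE E(2)] \<open>0 \<le> m\<close>])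
      fix s assume "s \<in> E - D"
      then show "norm (exp_L (E \<inter> {..s}) \<phi> x) \<le> m"
        using e(6)[of s] e(1) y_le[of s] by (auto simp: y_def)
    qed auto
    also have "\<dots> \<le> m * h"
      using de(4) e(5) h(1) \<open>0 \<le> m\<close> by (intro mult_left_mono) auto
    finally show ?thesis by (simp add: blinfun.diff_left)
  qed
  have "m \<le> norm (exp_L D \<phi> x) + m * h"
    unfolding m_def
  proof (rule cSup_least)
    fix v assume "v \<in> y ` (J - D)"
    then obtain s where s: "s \<in> J - D" "v = y s" by blast
    have "norm (exp_L (J \<inter> {..s}) \<phi> x - exp_L D \<phi> x) \<le> m * h"
      by (intro bound initial_segment_atMost d(7) s)
    then show "v \<le> norm (exp_L D \<phi> x) + Sup (y ` (J - D)) * h"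
      unfolding s y_def[of s] m_def[symmetric]
      using norm_triangle_ineq2[of "exp_L (J \<inter> {..s}) \<phi> x" "exp_L D \<phi> x"] by linarith
  qed (use False in auto)
  then have "m * (1 - h) \<le> norm (exp_L D \<phi> x)" by (simp add: algebra_simps)
  then have "m \<le> norm (exp_L D \<phi> x) / (1 - h)" using h(2) by (simp add: pos_le_divide_eq)
  then have "m * h \<le> norm (exp_L D \<phi> x) / (1 - h) * h" using \<open>0 \<le> h\<close> by (rule mult_right_mono)
  moreover have "norm (exp_L J \<phi> x - exp_L D \<phi> x) \<le> m * h"
    using D by (intro bound) (auto simp: initial_segment_def)
  ultimately show ?thesis by (simp add: mult.commute)
qed

lemma exp_L_null:
  fixes \<phi> :: "real set \<Rightarrow> ('h::{real_normed_vector,complete_space} \<Rightarrow>\<^sub>L 'h)"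
  assumes om: "ordered_measure J \<phi>" and "tvar \<phi> J = 0"
  shows "exp_L J \<phi> = id_blinfun"
proof -
  have "norm (time_ordered_integral \<phi> (Suc k) J) \<le> 1 / 2 ^ k * tvar \<phi> J" for k
  proof (rule has_op_integral_norm_bound[OF om ordered_measure_borel[OF om] order_refl
        time_ordered_integral_has_integral[OF om]])
    fix s
    show "norm (time_ordered_integral \<phi> k (J \<inter> {..s})) \<le> 1 / 2 ^ k"
      using initial_segmentD(5)[OF om initial_segment_atMost[of J s]] assms(2)
        time_ordered_integral_geometric[OF initial_segment_ordered_measure[OF om initial_segment_atMost], of s 0 k]
      by simp
  qed auto
  then have "time_ordered_integral \<phi> (Suc k) J = 0" for k
    using assms(2) by (simp del: time_ordered_integral.simps)
  then show ?thesis by (simp add: exp_L_def del: time_ordered_integral.simps)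
qed

section \<open>Complex linearity of the time-ordered exponential\<close>

lemma norm_scaleC: "norm (scaleC c x) = cmod c * norm x"
proof -
  have "cinner (scaleC c x) (scaleC c x) = (c * cnj c) * cinner x x"
    using cinner_commute[of x "scaleC c x"] cinner_commute[of x x]
    by (simp add: cinner_scaleC_left)
  then have "(norm (scaleC c x))\<^sup>2 = (cmod c * norm x)\<^sup>2"
    by (simp add: power2_norm_eq_inner inner_Re_cinner power_mult_distrib flip: complex_norm_square)
  then show ?thesis by (simp add: power2_eq_iff_nonneg)
qed

lemma bounded_linear_scaleC: "bounded_linear (scaleC c)"
proof (rule bounded_linear_intro[of _ "cmod c"])
  show "scaleC c (r *\<^sub>R x) = r *\<^sub>R scaleC c x" for r x
    by (simp add: scaleR_scaleC scaleC_scaleC mult.commute)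
qed (simp_all add: scaleC_add_right norm_scaleC mult.commute)

lemma complex_linear_LIMSEQ:
  assumes "\<And>n. complex_linear (X n)" "X \<longlonglongrightarrow> L"
  shows "complex_linear L"
  unfolding complex_linear_def
proof (intro allI)
  fix c x
  have pt: "(\<lambda>n. X n y) \<longlonglongrightarrow> L y" for y
    using bounded_linear.tendsto[OF blinfun.bounded_linear_left assms(2)] .
  have "(\<lambda>n. X n (scaleC c x)) \<longlonglongrightarrow> scaleC c (L x)"
    using bounded_linear.tendsto[OF bounded_linear_scaleC pt[of x], of c] assms(1)
    by (simp add: complex_linear_def)
  then show "L (scaleC c x) = scaleC c (L x)" using pt by (rule LIMSEQ_unique[rotated])
qed

lemma complex_linear_sum:
  assumes "\<And>i. i \<in> K \<Longrightarrow> complex_linear (f i)" shows "complex_linear (\<Sum>i\<in>K. f i)"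
  using assms
  by (simp add: complex_linear_def blinfun.sum_left linear_sum[OF bounded_linear.linear[OF bounded_linear_scaleC]])

lemma complex_linear_compose: "complex_linear A \<Longrightarrow> complex_linear B \<Longrightarrow> complex_linear (A o\<^sub>L B)"
  by (simp add: complex_linear_def)

text \<open>The approximants take their values among those of the integrand, which are complex
  linear by induction. Their simple integrals are therefore sums of compositions of complex linear
  operators, and the property is closed under limits.\<close>

lemma complex_linear_time_ordered_integral:
  fixes \<phi> :: "real set \<Rightarrow> ('c::complex_hilbert_space \<Rightarrow>\<^sub>L 'c)"
  assumes "ordered_measure J \<phi>" "\<And>E. E \<in> sets borel \<Longrightarrow> E \<subseteq> J \<Longrightarrow> complex_linear (\<phi> E)"
  shows "complex_linear (time_ordered_integral \<phi> k J)"
  using assms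
proof (induction k arbitrary: J)
  case 0
  then show ?case by (simp add: complex_linear_def)
next
  case (Suc k)
  note om = Suc.prems(1)
  note J = ordered_measure_borel[OF om] order_refl[of J]
  let ?f = "\<lambda>s. time_ordered_integral \<phi> k (J \<inter> {..s})"
  have f: "complex_linear (?f t)" for t
    by (intro Suc.IH initial_segment_ordered_measure[OF om initial_segment_atMost] Suc.prems(2)) auto
  obtain s where s: "\<forall>n. simple_function (restrict_space borel J) (s n) \<and> s n ` J \<subseteq> ?f ` J \<and>
      (\<forall>t\<in>J. norm (s n t - ?f t) < 1 / real (Suc n))"
    using tvar_lipschitz_approx_seq[OF om J time_ordered_integral_lipschitz[OF om]] by blast
  then obtain v where v: "has_op_integral \<phi> J ?f v" "(\<lambda>n. simple_op_integral \<phi> J (s n)) \<longlonglongrightarrow> v"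
    using has_op_integral_of_approx[OF om J, of s ?f] by blast
  have "complex_linear (simple_op_integral \<phi> J (s n))" for n
    unfolding simple_op_integral_def
  proof (intro complex_linear_sum complex_linear_compose Suc.prems(2))
    show "s n -` {y} \<inter> J \<in> sets borel" for y
      using simple_function_cells(2)[OF J(1)] s by blast
    show "complex_linear y" if "y \<in> s n ` J" for y
    proof -
      have "y \<in> ?f ` J" using s that by blast
      then show ?thesis using f by (elim imageE) simp
    qed
  qed auto
  then have "complex_linear v" using v(2) by (rule complex_linear_LIMSEQ)
  moreover have "time_ordered_integral \<phi> (Suc k) J = v"
    using op_integral_eq[OF om J v(1)] by simp
  ultimately show ?case by (simp only:)
qed

lemma complex_linear_exp_L:
  fixes \<phi> :: "real set \<Rightarrow> ('c::complex_hilbert_space \<Rightarrow>\<^sub>L 'c)"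
  assumes om: "ordered_measure J \<phi>" and \<phi>: "\<And>E. E \<in> sets borel \<Longrightarrow> E \<subseteq> J \<Longrightarrow> complex_linear (\<phi> E)"
  shows "complex_linear (exp_L J \<phi>)"
proof (rule complex_linear_LIMSEQ)
  show "complex_linear (\<Sum>k<n. time_ordered_integral \<phi> k J)" for n
    by (intro complex_linear_sum complex_linear_time_ordered_integral om \<phi>)
  show "(\<lambda>n. \<Sum>k<n. time_ordered_integral \<phi> k J) \<longlonglongrightarrow> exp_L J \<phi>"
    unfolding exp_L_eq_suminf[OF om] by (rule summable_LIMSEQ[OF summable_time_ordered_integral[OF om]])
qed

section \<open>Polygonal approximation and passage to the limit\<close>

lemma step_rate_nonneg:
  fixes h :: real
  assumes "0 \<le> h" "h < 1 / 2"
  shows "0 \<le> ln ((1 - h) / (1 - 2 * h))"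
proof (rule ln_ge_zero)
  show "1 \<le> (1 - h) / (1 - 2 * h)" using assms by simp
qed

text \<open>The rate g solves 1 - exp (- g) = h / (1 - h), matching the chord bound of
  \<open>exp_L_step\<close> with the reach of \<open>qform_step\<close>; h < 1 / 2 keeps the
  right-hand side below 1.\<close>

lemma qform_exp_L_steps:
  fixes \<phi> :: "real set \<Rightarrow> ('h::{real_inner,complete_space} \<Rightarrow>\<^sub>L 'h)"
  assumes t: "0 \<le> t" "t \<le> pi" and h: "0 \<le> h" "h < 1 / 2" and g: "g = ln ((1 - h) / (1 - 2 * h))"
    and p: "0 < p" "(p + real j * g) * sin t < pi" and x: "x \<noteq> 0"
    and start: "0 \<le> qform p t x y" and om: "ordered_measure J \<phi>" and var: "tvar \<phi> J \<le> real j * h"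
  shows "0 \<le> qform (p + real j * g) t x (exp_L J \<phi> y)"
  using p(2) om var
proof (induction j arbitrary: J)
  case 0
  then have "tvar \<phi> J = 0" using tvar_nonneg[of \<phi> J] by simp
  then show ?case using exp_L_null[OF 0(2)] start by simp
next
  case (Suc j)
  note om = Suc.prems(2)
  have "0 \<le> g" unfolding g using h by (rule step_rate_nonneg)
  have "exp (- g) = (1 - 2 * h) / (1 - h)"
    using h by (simp add: g exp_minus)
  then have rate: "1 - exp (- g) = h / (1 - h)" using h by (simp add: field_simps)
  have "0 \<le> sin t" using t by (rule sin_ge_zero)
  have eq: "p + real (Suc j) * g = (p + real j * g) + g" by (simp add: algebra_simps)
  have le: "(p + real j * g) * sin t \<le> ((p + real j * g) + g) * sin t"
    using \<open>0 \<le> g\<close> \<open>0 \<le> sin t\<close> by (intro mult_right_mono) auto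
  \<comment> \<open>Splits off the latest piece, so that the exponential over D is the preceding
    vertex; \<open>max\<close> covers a total variation below h.\<close>
  obtain D where D: "initial_segment D J" "tvar \<phi> D = max 0 (tvar \<phi> J - h)"
    using initial_segment_tvar_exists[OF om, of "max 0 (tvar \<phi> J - h)"] h by auto
  have "tvar \<phi> D \<le> real j * h"
    unfolding D(2) using Suc.prems(3) h by (auto simp: algebra_simps)
  then have IH: "0 \<le> qform (p + real j * g) t x (exp_L D \<phi> y)"
    using le_less_trans[OF le Suc.prems(1)[unfolded eq]]
    by (intro Suc.IH initial_segment_ordered_measure[OF om D(1)])
  have "norm (exp_L J \<phi> y - exp_L D \<phi> y) \<le> h / (1 - h) * norm (exp_L D \<phi> y)"
    using D(2) h by (intro exp_L_step[OF om D(1)]) auto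
  then have "0 \<le> qform ((p + real j * g) + g) t x (exp_L D \<phi> y + (exp_L J \<phi> y - exp_L D \<phi> y))"
    using p(1) \<open>0 \<le> g\<close> Suc.prems(1) x IH unfolding eq
    by (intro qform_step t) (auto simp: rate add_pos_nonneg)
  then show ?case unfolding eq by simp
qed

text \<open>The rate is h + O(h ^ 2), so n steps with h = d / n advance the parameter by d + O(1 /
  n).\<close>

lemma step_rate_limit:
  assumes "0 \<le> d"
  shows "(\<lambda>n. real n * ln ((1 - d / real n) / (1 - 2 * (d / real n)))) \<longlonglongrightarrow> d"
proof (cases "d = 0")
  case False
  then have "0 < d" using assms by simp
  then show ?thesis by real_asymp
qed simp

lemma qform_exp_L:
  fixes \<phi> :: "real set \<Rightarrow> ('h::{real_inner,complete_space} \<Rightarrow>\<^sub>L 'h)"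
  assumes t: "0 \<le> t" "t \<le> pi" and p: "0 \<le> p" "p \<le> q" and q: "sin t \<noteq> 0 \<Longrightarrow> q \<le> pi / sin t"
    and om: "ordered_measure I \<phi>" and var: "tvar \<phi> I \<le> q - p"
    and start: "0 \<le> qform p t x y" and zero: "x = 0 \<Longrightarrow> y = 0"
  shows "0 \<le> qform q t x (exp_L I \<phi> y)"
proof (cases "x = 0")
  \<comment> \<open>The path estimate divides by \<open>norm x\<close>; at x = 0 the vector y is 0
    as well and the form vanishes.\<close>
  case True
  then show ?thesis using zero by (simp add: qform_def)
next
  case x: False
  have "0 \<le> sin t" using t by (rule sin_ge_zero)
  show ?thesis
  proof (cases "q * sin t < pi")
    case False
    then have "sin t \<noteq> 0" by auto
    moreover then have "q * sin t \<le> pi" using q \<open>0 \<le> sin t\<close> by (simp add: pos_le_divide_eq)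
    ultimately show ?thesis using False by (intro qform_extreme) auto
  next
    case True
    define d where "d = q - p"
    have "0 \<le> d" using p by (simp add: d_def)
    define g where "g n = ln ((1 - d / real n) / (1 - 2 * (d / real n)))" for n
    \<comment> \<open>The parameter reached after the initial shift and n steps. Only this parameter
      depends on n, the endpoint \<open>exp_L I \<phi> y\<close> does not, so continuity of the form
      in the parameter suffices for the limit.\<close>
    define r where "r n = (p + 1 / real n) + real n * g n" for n
    have "r \<longlonglongrightarrow> (p + 0) + d"
      unfolding r_def g_def
      by (intro tendsto_add tendsto_const lim_1_over_n step_rate_limit \<open>0 \<le> d\<close>)
    then have r: "r \<longlonglongrightarrow> q" by (simp add: d_def)
    have "(\<lambda>n. d * (1 / real n)) \<longlonglongrightarrow> d * 0"
      by (intro tendsto_mult tendsto_const lim_1_over_n)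
    then have "\<forall>\<^sub>F n in sequentially. d * (1 / real n) < 1 / 2"
      by (rule order_tendstoD(2)) simp
    moreover have "\<forall>\<^sub>F n in sequentially. r n * sin t < pi"
      using True by (intro order_tendstoD(2)[OF tendsto_mult[OF r tendsto_const]])
    moreover have "\<forall>\<^sub>F n in sequentially. 0 < n" by (rule eventually_gt_at_top)
    ultimately have "\<forall>\<^sub>F n in sequentially. 0 \<le> qform (r n) t x (exp_L I \<phi> y)"
    proof eventually_elim
      case (elim n)
      have h: "0 \<le> d / real n" "d / real n < 1 / 2" using elim \<open>0 \<le> d\<close> by auto
      have "0 \<le> g n" unfolding g_def using h by (rule step_rate_nonneg)
      then have "(p + 1 / real n) * sin t \<le> r n * sin t"
        using \<open>0 \<le> sin t\<close> by (intro mult_right_mono) (auto simp: r_def)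
      then have "0 \<le> qform (p + 1 / real n) t x y"
        using elim p by (intro qform_pos_shift[OF t _ _ _ x start]) auto
      moreover have "0 < p + 1 / real n" using elim p by (simp add: add_nonneg_pos)
      moreover have "tvar \<phi> I \<le> real n * (d / real n)" using elim var by (simp add: d_def)
      ultimately show ?case
        using qform_exp_L_steps[OF t h g_def _ _ x _ om] elim unfolding r_def by blast
    qed
    moreover have "(\<lambda>n. qform (r n) t x (exp_L I \<phi> y)) \<longlonglongrightarrow> qform q t x (exp_L I \<phi> y)"
      by (rule isCont_tendsto_compose[OF isCont_qform[OF t] r])
    ultimately show ?thesis by (intro tendsto_lowerbound[OF _ _ sequentially_bot])
  qed
qed

lemma calE_exp_L:
  fixes \<phi> :: "real set \<Rightarrow> ('h::{real_inner,complete_space} \<Rightarrow>\<^sub>L 'h)"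
  assumes t: "0 \<le> t" "t \<le> pi" and p: "0 \<le> p" "p \<le> q" and q: "sin t \<noteq> 0 \<Longrightarrow> q \<le> pi / sin t"
    and om: "ordered_measure I \<phi>" and var: "variation \<phi> I \<le> ennreal (q - p)"
    and A: "calE inner p t A"
  shows "calE inner q t (exp_L I \<phi> o\<^sub>L A)"
  unfolding calE_inner_iff
proof
  fix x
  have "tvar \<phi> I \<le> q - p"
    using var p variation_eq_tvar[OF om ordered_measure_borel[OF om] order_refl] by simp
  moreover have "0 \<le> qform p t x (A x)" using A by (simp add: calE_inner_iff)
  ultimately show "0 \<le> qform q t x ((exp_L I \<phi> o\<^sub>L A) x)"
    using qform_exp_L[OF t p q om, of x "A x"] by (simp add: blinfun.zero_right)
qed

theorem theorem8p1:
  fixes t p q :: real and I :: "real set"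
  assumes "0 \<le> t" and "t \<le> pi"
    and "0 \<le> p" and "p \<le> q" and "sin t \<noteq> 0 \<Longrightarrow> q \<le> pi / sin t"
  shows
    "(\<forall>(\<phi> :: real set \<Rightarrow> ('h::{real_inner,complete_space} \<Rightarrow>\<^sub>L 'h)) (A :: 'h \<Rightarrow>\<^sub>L 'h).
        ordered_measure I \<phi> \<longrightarrow>
        variation \<phi> I \<le> ennreal (q - p) \<longrightarrow>
        calE inner p t A \<longrightarrow>
        calE inner q t (exp_L I \<phi> o\<^sub>L A)) \<and>
     (\<forall>(\<phi> :: real set \<Rightarrow> ('c::complex_hilbert_space \<Rightarrow>\<^sub>L 'c)) (A :: 'c \<Rightarrow>\<^sub>L 'c).
        ordered_measure I \<phi> \<longrightarrow>
        (\<forall>E. E \<in> sets borel \<longrightarrow> E \<subseteq> I \<longrightarrow> complex_linear (\<phi> E)) \<longrightarrow>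
        complex_linear A \<longrightarrow>
        variation \<phi> I \<le> ennreal (q - p) \<longrightarrow>
        calE cinner p t A \<longrightarrow>
        calE cinner q t (exp_L I \<phi> o\<^sub>L A))"
proof (intro conjI allI impI)
  fix \<phi> :: "real set \<Rightarrow> ('h \<Rightarrow>\<^sub>L 'h)" and A :: "'h \<Rightarrow>\<^sub>L 'h"
  assume "ordered_measure I \<phi>" "variation \<phi> I \<le> ennreal (q - p)" "calE inner p t A"
  with assms show "calE inner q t (exp_L I \<phi> o\<^sub>L A)" by (intro calE_exp_L)
next
  fix \<phi> :: "real set \<Rightarrow> ('c \<Rightarrow>\<^sub>L 'c)" and A :: "'c \<Rightarrow>\<^sub>L 'c"
  assume om: "ordered_measure I \<phi>"
    and \<phi>: "\<forall>E. E \<in> sets borel \<longrightarrow> E \<subseteq> I \<longrightarrow> complex_linear (\<phi> E)"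
    and A: "complex_linear A" and var: "variation \<phi> I \<le> ennreal (q - p)" and "calE cinner p t A"
  \<comment> \<open>The complex space is now treated as a real one; complex linearity of the product
    is what permits the return to \<open>cinner\<close>.\<close>
  then have "calE inner p t A" by (simp add: calE_cinner_iff)
  then have "calE inner q t (exp_L I \<phi> o\<^sub>L A)"
    using assms om var by (intro calE_exp_L)
  moreover have "complex_linear (exp_L I \<phi> o\<^sub>L A)"
    using \<phi> A by (intro complex_linear_compose complex_linear_exp_L om) auto
  ultimately show "calE cinner q t (exp_L I \<phi> o\<^sub>L A)" by (simp add: calE_cinner_iff)
qed

end
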